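(* Let $\mathcal{H}$ be a complex Hilbert space and let $H : \mathcal{H} \to \mathcal{H}$ be a bounded self-adjoint operator. Let $\mathcal{H}_{eac} \subset \mathcal{H}$ be the eventually absolutely continuous subspace associated with $H$, i.e. $$\mathcal{H}_{eac} = \overline{\{\psi \in \mathcal{H} \ | \ \exists N \geq 1,\ \mu_{\psi^{\otimes N}} \ll \lambda\}},$$ where the closure is in the norm of $\mathcal{H}$. Suppose that $\psi \in \mathcal{H}_{eac}$. Then for every $\varphi \in \mathcal{H}$, $$\langle e^{itH}\psi, \varphi\rangle \longrightarrow 0 \quad \text{as } t \to \infty.$$
   Context: $\lambda$ denotes Lebesgue measure on $\mathbb{R}$, and $\ll$ denotes absolute continuity. For a bounded self-adjoint operator $A$ on a Hilbert space $\mathcal{K}$ and $u \in \mathcal{K}$, the spectral measure of $u$ associated with $A$ is the finite positive Borel measure $\mu$ on $\mathbb{R}$, supported on the spectrum $\sigma(A)$, such that $\langle f(A)u,u\rangle = \int f\, d\mu$ for every continuous $f : \sigma(A) \to \mathbb{C}$. For $\psi \in \mathcal{H}$, $\mu_\psi$ is the spectral measure of $\psi$ associated with $H$. For an integer $N \geq 1$, let $\mathcal{H}^{\otimes N}$ be the $N$-fold Hilbert space tensor product of $\mathcal{H}$. For $1 \le k \le N$ let $H_k = I \otimes \dots \otimes H \otimes \dots \otimes I$ (with $H$ in the $k$-th position), acting on $\mathcal{H}^{\otimes N}$, and let $\widehat{H} = \sum_{k=1}^N H_k$, which is a bounded self-adjoint operator on $\mathcal{H}^{\otimes N}$. Then $\mu_{\psi^{\otimes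 N}}$ denotes the spectral measure of $\psi^{\otimes N} = \psi \otimes \dots \otimes \psi \in \mathcal{H}^{\otimes N}$ associated with $\widehat{H}$. Recall that $\mu_{\psi^{\otimes N}} = \mu_\psi^{*N}$, the $N$-fold convolution of $\mu_\psi$ with itself. *)

theory Defs
  imports
    "HOL-Analysis.Analysis"
    "HOL-Computational_Algebra.Polynomial"
    "HOL-Library.Function_Algebras"
begin

section \<open>Complex Hilbert spaces\<close>

text \<open>
  The tensor powers of a Hilbert space depend on a number that is quantified inside the
  statement, so Hilbert spaces are given by explicit carriers instead of a type class: a linear
  subspace of an ambient complex vector space, with an inner product on this subspace.
  The inner product is linear in its first argument.  Operators on the space are functions on the
  ambient type; only their values on the carrier are relevant.
\<close>

record 'v inner_space =
  vecs :: "'v set"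
  scl :: "complex \<Rightarrow> 'v \<Rightarrow> 'v"
  ip :: "'v \<Rightarrow> 'v \<Rightarrow> complex"

definition hnorm :: "'v inner_space \<Rightarrow> 'v \<Rightarrow> real" where
  "hnorm K x = sqrt (Re (ip K x x))"

definition hlimit :: "'v::ab_group_add inner_space \<Rightarrow> (nat \<Rightarrow> 'v) \<Rightarrow> 'v \<Rightarrow> bool" where
  "hlimit K X x \<longleftrightarrow> x \<in> vecs K \<and> (\<lambda>n. hnorm K (X n - x)) \<longlonglongrightarrow> 0"

definition hcauchy :: "'v::ab_group_add inner_space \<Rightarrow> (nat \<Rightarrow> 'v) \<Rightarrow> bool" where
  "hcauchy K X \<longleftrightarrow> (\<forall>e>0. \<exists>M. \<forall>m\<ge>M. \<forall>n\<ge>M. hnorm K (X m - X n) < e)"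

definition hclosure :: "'v::ab_group_add inner_space \<Rightarrow> 'v set \<Rightarrow> 'v set" where
  "hclosure K S = {x \<in> vecs K. \<forall>e>0. \<exists>y\<in>S. hnorm K (x - y) < e}"

locale complex_hilbert_space = vector_space "scl K"
  for K :: "'v::ab_group_add inner_space" +
  assumes subspace_vecs: "subspace (vecs K)"
    and ip_add_left:
      "\<And>x y z. \<lbrakk>x \<in> vecs K; y \<in> vecs K; z \<in> vecs K\<rbrakk> \<Longrightarrow> ip K (x + y) z = ip K x z + ip K y z"
    and ip_scl_left:
      "\<And>c x y. \<lbrakk>x \<in> vecs K; y \<in> vecs K\<rbrakk> \<Longrightarrow> ip K (scl K c x) y = c * ip K x y"
    and ip_cnj: "\<And>x y. \<lbrakk>x \<in> vecs K; y \<in> vecs K\<rbrakk> \<Longrightarrow> ip K y x = cnj (ip K x y)"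
    and ip_pos: "\<And>x. \<lbrakk>x \<in> vecs K; x \<noteq> 0\<rbrakk> \<Longrightarrow> 0 < Re (ip K x x)"
    and complete_vecs: "\<And>X. \<lbrakk>\<And>n. X n \<in> vecs K; hcauchy K X\<rbrakk> \<Longrightarrow> \<exists>x. hlimit K X x"


section \<open>Bounded operators\<close>

definition bounded_operator :: "'v::ab_group_add inner_space \<Rightarrow> ('v \<Rightarrow> 'v) \<Rightarrow> bool" where
  "bounded_operator K A \<longleftrightarrow>
     (\<forall>x\<in>vecs K. A x \<in> vecs K) \<and>
     (\<forall>x\<in>vecs K. \<forall>y\<in>vecs K. A (x + y) = A x + A y) \<and>
     (\<forall>c. \<forall>x\<in>vecs K. A (scl K c x) = scl K c (A x)) \<and>
     (\<exists>C. \<forall>x\<in>vecs K. hnorm K (A x) \<le> C * hnorm K x)"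

definition bounded_self_adjoint :: "'v::ab_group_add inner_space \<Rightarrow> ('v \<Rightarrow> 'v) \<Rightarrow> bool" where
  "bounded_self_adjoint K A \<longleftrightarrow>
     bounded_operator K A \<and> (\<forall>x\<in>vecs K. \<forall>y\<in>vecs K. ip K (A x) y = ip K x (A y))"

definition opnorm :: "'v::ab_group_add inner_space \<Rightarrow> ('v \<Rightarrow> 'v) \<Rightarrow> real" where
  "opnorm K A = (SUP x\<in>{x \<in> vecs K. hnorm K x \<le> 1}. hnorm K (A x))"

definition op_spectrum :: "'v::ab_group_add inner_space \<Rightarrow> ('v \<Rightarrow> 'v) \<Rightarrow> complex set" where
  "op_spectrum K A =
     {z. \<not> (\<exists>B. bounded_operator K B \<and>
               (\<forall>x\<in>vecs K. B (A x - scl K z x) = x \<and> A (B x) - scl K z (B x) = x))}"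

text \<open>For self-adjoint operators this is the whole spectrum, regarded as a subset of the reals.\<close>

definition real_spectrum :: "'v::ab_group_add inner_space \<Rightarrow> ('v \<Rightarrow> 'v) \<Rightarrow> real set" where
  "real_spectrum K A = {x. complex_of_real x \<in> op_spectrum K A}"

definition poly_op ::
    "'v::ab_group_add inner_space \<Rightarrow> ('v \<Rightarrow> 'v) \<Rightarrow> complex poly \<Rightarrow> 'v \<Rightarrow> 'v" where
  "poly_op K A p x = (\<Sum>i\<le>degree p. scl K (coeff p i) ((A ^^ i) x))"

text \<open>
  Continuous functional calculus, for bounded self-adjoint \<open>A\<close>: the operator \<open>f(A)\<close>
  is the norm limit of \<open>p\<^sub>n(A)\<close> for polynomials \<open>p\<^sub>n\<close> that converge to
  \<open>f\<close> uniformly on the spectrum.  It exists for every \<open>f\<close> continuous on the spectrum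
  (Weierstrass) and does not depend on the polynomials, since the operator norm of \<open>p(A)\<close>
  is the supremum of \<open>|p|\<close> over the spectrum.
\<close>

definition is_fun_of_operator ::
    "'v::ab_group_add inner_space \<Rightarrow> ('v \<Rightarrow> 'v) \<Rightarrow> (real \<Rightarrow> complex) \<Rightarrow> ('v \<Rightarrow> 'v) \<Rightarrow> bool" where
  "is_fun_of_operator K A f B \<longleftrightarrow>
     bounded_operator K B \<and>
     (\<exists>p :: nat \<Rightarrow> complex poly.
        uniform_limit (real_spectrum K A) (\<lambda>n x. poly (p n) (complex_of_real x)) f sequentially \<and>
        (\<lambda>n. opnorm K (\<lambda>x. poly_op K A (p n) x - B x)) \<longlonglongrightarrow> 0)"

definition is_spectral_measure ::
    "'v::ab_group_add inner_space \<Rightarrow> ('v \<Rightarrow> 'v) \<Rightarrow> 'v \<Rightarrow> real measure \<Rightarrow> bool" where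
  "is_spectral_measure K A u \<mu> \<longleftrightarrow>
     sets \<mu> = sets borel \<and> finite_measure \<mu> \<and> emeasure \<mu> (- real_spectrum K A) = 0 \<and>
     (\<forall>f B. continuous_on (real_spectrum K A) f \<longrightarrow> is_fun_of_operator K A f B \<longrightarrow>
        ip K (B u) u = (LINT x:real_spectrum K A|\<mu>. f x))"

definition exp_i_op ::
    "'v::ab_group_add inner_space \<Rightarrow> ('v \<Rightarrow> 'v) \<Rightarrow> real \<Rightarrow> 'v \<Rightarrow> 'v" where
  "exp_i_op K A t x =
     (THE y. hlimit K (\<lambda>n. \<Sum>k<n. scl K ((\<i> * complex_of_real t) ^ k / fact k) ((A ^^ k) x)) y)"


section \<open>Hilbert space tensor powers\<close>

text \<open>The lists \<open>[x\<^sub>1, \<dots>, x\<^sub>N]\<close> of vectors.\<close>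

definition tuples :: "'v inner_space \<Rightarrow> nat \<Rightarrow> 'v list set" where
  "tuples H N = {xs. length xs = N \<and> set xs \<subseteq> vecs H}"

text \<open>
  \<open>K\<close>, with the map \<open>\<tau>\<close> sending \<open>[x\<^sub>1, \<dots>, x\<^sub>N]\<close> to
  \<open>x\<^sub>1 \<otimes> \<dots> \<otimes> x\<^sub>N\<close>, is the \<open>N\<close>-fold Hilbert space tensor product
  of \<open>H\<close>.  These properties determine \<open>(K, \<tau>)\<close> up to a unique unitary operator.
\<close>

definition is_tensor_power ::
    "'v::ab_group_add inner_space \<Rightarrow> nat \<Rightarrow> 'w::ab_group_add inner_space \<Rightarrow> ('v list \<Rightarrow> 'w) \<Rightarrow> bool"
  where
  "is_tensor_power H N K \<tau> \<longleftrightarrow>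
     complex_hilbert_space K \<and>
     (\<forall>xs\<in>tuples H N. \<tau> xs \<in> vecs K) \<and>
     (\<forall>xs\<in>tuples H N. \<forall>i<N. \<forall>x\<in>vecs H. \<forall>y\<in>vecs H.
        \<tau> (xs[i := x + y]) = \<tau> (xs[i := x]) + \<tau> (xs[i := y])) \<and>
     (\<forall>xs\<in>tuples H N. \<forall>i<N. \<forall>c. \<forall>x\<in>vecs H.
        \<tau> (xs[i := scl H c x]) = scl K c (\<tau> (xs[i := x]))) \<and>
     (\<forall>xs\<in>tuples H N. \<forall>ys\<in>tuples H N.
        ip K (\<tau> xs) (\<tau> ys) = (\<Prod>i<N. ip H (xs ! i) (ys ! i))) \<and>
     hclosure K (module.span (scl K) (\<tau> ` tuples H N)) = vecs K"

text \<open>\<open>T\<close> is \<open>I \<otimes> \<dots> \<otimes> A \<otimes> \<dots> \<otimes> I\<close>, with \<open>A\<close> in position \<open>k\<close>, counted from 0.\<close>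

definition is_factor_operator ::
    "'v::ab_group_add inner_space \<Rightarrow> nat \<Rightarrow> 'w::ab_group_add inner_space \<Rightarrow> ('v list \<Rightarrow> 'w) \<Rightarrow>
     ('v \<Rightarrow> 'v) \<Rightarrow> nat \<Rightarrow> ('w \<Rightarrow> 'w) \<Rightarrow> bool" where
  "is_factor_operator H N K \<tau> A k T \<longleftrightarrow>
     bounded_operator K T \<and> (\<forall>xs\<in>tuples H N. T (\<tau> xs) = \<tau> (xs[k := A (xs ! k)]))"

text \<open>
  \<open>\<mu>\<close> is the spectral measure of \<open>\<psi> \<otimes> \<dots> \<otimes> \<psi>\<close> associated with the sum of
  the operators \<open>A\<close> acting in the \<open>N\<close> factors.  It does not depend on the realisation
  \<open>(K, \<tau>)\<close>.  The type \<open>'v list \<Rightarrow> complex\<close> has room for one: the reproducing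
  kernel Hilbert space, on \<open>tuples H N\<close>, of the kernel
  \<open>\<langle>x\<^sub>1, y\<^sub>1\<rangle> \<cdots> \<langle>x\<^sub>N, y\<^sub>N\<rangle>\<close>, its elements extended by 0 to all lists.
\<close>

definition is_tensor_spectral_measure ::
    "'v::ab_group_add inner_space \<Rightarrow> ('v \<Rightarrow> 'v) \<Rightarrow> nat \<Rightarrow> 'v \<Rightarrow> real measure \<Rightarrow> bool" where
  "is_tensor_spectral_measure H A N \<psi> \<mu> \<longleftrightarrow>
     (\<exists>(K :: ('v list \<Rightarrow> complex) inner_space) \<tau> T.
        is_tensor_power H N K \<tau> \<and>
        (\<forall>k<N. is_factor_operator H N K \<tau> A k (T k)) \<and>
        is_spectral_measure K (\<lambda>F. \<Sum>k<N. T k F) (\<tau> (replicate N \<psi>)) \<mu>)"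

definition H_eac :: "'v::ab_group_add inner_space \<Rightarrow> ('v \<Rightarrow> 'v) \<Rightarrow> 'v set" where
  "H_eac H A = hclosure H
     {\<psi> \<in> vecs H. \<exists>N\<ge>1. \<exists>\<mu>. is_tensor_spectral_measure H A N \<psi> \<mu> \<and> absolutely_continuous lborel \<mu>}"

end

theory Submission
  imports Defs
begin

text \<open>
  Write \<open>\<chi> t = \<langle>e\<^sup>i\<^sup>t\<^sup>A \<psi>, \<psi>\<rangle>\<close> for the autocorrelation of \<open>\<psi>\<close>.  Two observations carry the proof.

  First, suppose that the spectral measure \<open>\<mu>\<close> of the \<open>N\<close>-fold tensor power of \<open>\<psi>\<close> is absolutely
  continuous.  The summands of the operator on the tensor power act on different factors, so its
  exponential is the product of the exponentials on the factors, and the Fourier transform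
  \<open>\<integral> e\<^sup>i\<^sup>t\<^sup>x d\<mu>\<close> is \<open>(\<chi> t)\<^sup>N\<close>.  By the Riemann-Lebesgue lemma (\<open>Riemann_Lebesgue_measure\<close>) it tends to
  0, hence so does \<open>\<chi> t\<close>.  The two sides are compared through their power series in \<open>t\<close>: the
  coefficients of the Fourier transform are, up to powers of \<open>\<i>\<close> and factorials, the moments of \<open>\<mu>\<close>, given by the powers of the
  operator (\<open>spectral_measure_fourier_sums\<close>), and a differential recursion shows that the
  exponential generating function of these moments is the \<open>N\<close>-th power of the one for \<open>A\<close>
  (\<open>tensor_sum_moments\<close>).  So only polynomials enter from the functional calculus.

  Second, \<open>\<chi> t \<longlonglongrightarrow> 0\<close> already gives \<open>\<langle>e\<^sup>i\<^sup>t\<^sup>A \<psi>, \<phi>\<rangle> \<longlonglongrightarrow> 0\<close> for every \<open>\<phi>\<close>.  Indeed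
  \<open>\<langle>e\<^sup>i\<^sup>t\<^sup>A \<psi>, e\<^sup>i\<^sup>s\<^sup>A \<psi>\<rangle> = \<chi> (t - s)\<close>, so vectors of the orbit at distant times are almost orthogonal,
  and a bounded family of almost orthogonal vectors converges weakly to 0, by an argument in the
  style of Bessel's inequality (\<open>weakly_null\<close>).

  Since \<open>e\<^sup>i\<^sup>t\<^sup>A\<close> is isometric, the property passes to the norm closure
  (\<open>exp_i_op_weakly_null_closure\<close>).
\<close>

section \<open>The Riemann-Lebesgue lemma for absolutely continuous measures\<close>

lemma borel_measurable_cis: "(\<lambda>x. cis (t * x)) \<in> borel_measurable borel"
  by (intro borel_measurable_continuous_onI continuous_intros)

lemma integrable_scaleR_cis:
  fixes g :: "real \<Rightarrow> real"
  assumes "integrable lborel g"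
  shows "integrable lborel (\<lambda>x. g x *\<^sub>R cis (t * x))"
  by (rule Bochner_Integration.integrable_bound[OF assms])
     (use assms borel_measurable_cis in \<open>auto intro!: borel_measurable_scaleR\<close>)

text \<open>
  Changing \<open>f\<close> by a small amount in \<open>L\<^sup>1\<close> changes all its Fourier integrals by a small amount,
  uniformly in \<open>t\<close>.  The \<open>L\<^sup>1\<close> convergence is stated as dominated pointwise convergence, the form
  in which it comes up in all the approximation steps below.
\<close>

lemma integral_cis_L1_tendsto:
  fixes f w :: "real \<Rightarrow> real" and s :: "nat \<Rightarrow> real \<Rightarrow> real"
  assumes s: "\<And>i. integrable lborel (s i)"
    and van: "\<And>i. ((\<lambda>t. \<integral>x. s i x *\<^sub>R cis (t * x) \<partial>lborel) \<longlongrightarrow> 0) at_top"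
    and lim: "\<And>x. (\<lambda>i. s i x) \<longlonglongrightarrow> f x"
    and dom: "\<And>i x. \<bar>s i x\<bar> \<le> w x" and w: "integrable lborel w" and f: "integrable lborel f"
  shows "((\<lambda>t. \<integral>x. f x *\<^sub>R cis (t * x) \<partial>lborel) \<longlongrightarrow> 0) at_top"
proof (rule tendstoI)
  fix e :: real assume e: "e > 0"
  have "(\<lambda>i. \<integral>x. \<bar>f x - s i x\<bar> \<partial>lborel) \<longlonglongrightarrow> (\<integral>x. 0 \<partial>(lborel::real measure))"
  proof (rule integral_dominated_convergence[where w = "\<lambda>x. \<bar>f x\<bar> + w x"])
    show "AE x in lborel. (\<lambda>i. \<bar>f x - s i x\<bar>) \<longlonglongrightarrow> 0"
    proof (rule AE_I2)
      fix x
      have "(\<lambda>i. \<bar>f x - s i x\<bar>) \<longlonglongrightarrow> \<bar>f x - f x\<bar>" by (intro tendsto_intros lim)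
      then show "(\<lambda>i. \<bar>f x - s i x\<bar>) \<longlonglongrightarrow> 0" by simp
    qed
    show "AE x in lborel. norm \<bar>f x - s i x\<bar> \<le> \<bar>f x\<bar> + w x" for i
      using dom[of i] by (intro AE_I2) (simp add: abs_triangle_ineq4[THEN order_trans])
  qed (use s f w in auto)
  then have "(\<lambda>i. \<integral>x. \<bar>f x - s i x\<bar> \<partial>lborel) \<longlonglongrightarrow> 0" by simp
  from order_tendstoD(2)[OF this, of "e/2"] e obtain i where i: "(\<integral>x. \<bar>f x - s i x\<bar> \<partial>lborel) < e/2"
    by (auto simp: eventually_sequentially)
  have "\<forall>\<^sub>F t in at_top. norm (\<integral>x. s i x *\<^sub>R cis (t * x) \<partial>lborel) < e/2"
    using tendstoD[OF van[of i], of "e/2"] e by simp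
  then show "\<forall>\<^sub>F t in at_top. dist (\<integral>x. f x *\<^sub>R cis (t * x) \<partial>lborel) 0 < e"
  proof eventually_elim
    case (elim t)
    have "(\<integral>x. f x *\<^sub>R cis (t * x) \<partial>lborel) =
        (\<integral>x. s i x *\<^sub>R cis (t * x) \<partial>lborel) + (\<integral>x. (f x - s i x) *\<^sub>R cis (t * x) \<partial>lborel)"
      by (subst Bochner_Integration.integral_add[symmetric])
         (auto intro!: integrable_scaleR_cis s f Bochner_Integration.integral_cong simp flip: scaleR_add_left)
    moreover have "norm (\<integral>x. (f x - s i x) *\<^sub>R cis (t * x) \<partial>lborel) \<le> (\<integral>x. \<bar>f x - s i x\<bar> \<partial>lborel)"
      using integral_norm_bound[of lborel "\<lambda>x. (f x - s i x) *\<^sub>R cis (t * x)"] by simp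
    ultimately show ?case
      using elim i norm_triangle_ineq[of "\<integral>x. s i x *\<^sub>R cis (t * x) \<partial>lborel"
          "\<integral>x. (f x - s i x) *\<^sub>R cis (t * x) \<partial>lborel"]
      by simp
  qed
qed

lemma integral_cis_interval_tendsto:
  fixes a b :: real
  shows "((\<lambda>t. \<integral>x. indicator {a..b} x *\<^sub>R cis (t * x) \<partial>lborel) \<longlongrightarrow> 0) at_top"
proof (cases "a \<le> b")
  case True
  have eq: "(\<integral>x. indicator {a..b} x *\<^sub>R cis (t * x) \<partial>lborel) = (cis (t * b) - cis (t * a)) / (\<i> * t)"
    if "t > 0" for t :: real
  proof -
    have "((\<lambda>x. cis (t * x) / (\<i> * t)) has_vector_derivative cis (t * x)) (at x within S)" for x S
      unfolding cis_conv_exp using that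
      by (auto intro!: derivative_eq_intros has_vector_derivative_real_field simp: field_simps)
    then have "(\<integral>x. indicator {a..b} x *\<^sub>R cis (t * x) \<partial>lborel) =
        cis (t * b) / (\<i> * t) - cis (t * a) / (\<i> * t)"
      by (intro integral_FTC_Icc True continuous_intros)
    then show ?thesis by (simp add: diff_divide_distrib)
  qed
  have "((\<lambda>t. (cis (t * b) - cis (t * a)) / (\<i> * of_real t)) \<longlongrightarrow> 0) at_top"
  proof (rule Lim_null_comparison)
    show "\<forall>\<^sub>F t in at_top. norm ((cis (t * b) - cis (t * a)) / (\<i> * of_real t)) \<le> 2 / t"
      using eventually_gt_at_top[of 0]
    proof eventually_elim
      case (elim t)
      then show ?case
        using norm_triangle_ineq4[of "cis (t * b)" "cis (t * a)"]
        by (simp add: norm_divide norm_mult divide_right_mono)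
    qed
    show "((\<lambda>t::real. 2 / t) \<longlongrightarrow> 0) at_top"
      by (intro tendsto_divide_0[OF tendsto_const] filterlim_at_top_imp_at_infinity filterlim_ident)
  qed
  moreover have "\<forall>\<^sub>F t in at_top. (cis (t * b) - cis (t * a)) / (\<i> * of_real t) =
      (\<integral>x. indicator {a..b} x *\<^sub>R cis (t * x) \<partial>lborel)"
    using eventually_gt_at_top[of 0] by eventually_elim (simp add: eq)
  ultimately show ?thesis
    by (rule Lim_transform_eventually)
qed simp

text \<open>
  The Borel sets with this property form a Dynkin system that contains the half-open
  intervals.  The restriction to \<open>{-c..c}\<close> makes complements and countable disjoint unions work:
  it keeps all indicators below one integrable function.
\<close>

lemma integral_cis_bounded_borel_set_tendsto:
  fixes B :: "real set" and c :: real
  assumes "B \<in> sets borel"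
  shows "((\<lambda>t. \<integral>x. indicator (B \<inter> {-c..c}) x *\<^sub>R cis (t * x) \<partial>lborel) \<longlongrightarrow> 0) at_top"
    (is "?P B")
proof -
  let ?G = "range (\<lambda>(a, b). {a<..b::real})"
  have B: "B \<in> sigma_sets UNIV ?G"
    using assms by (simp add: borel_sigma_sets_Ioc)
  have meas: "S \<in> sets borel" if "S \<in> sigma_sets UNIV ?G" for S
    using that by (simp add: borel_sigma_sets_Ioc)
  have int: "integrable lborel (indicator (S \<inter> {-c..c}) :: real \<Rightarrow> real)"
    if "S \<in> sets borel" for S
    using that emeasure_mono[of "S \<inter> {-c..c}" "{-c..c}" lborel]
    by (intro integrable_real_indicator) (auto simp: emeasure_lborel_Icc_eq le_less_trans split: if_splits)
  have "Int_stable ?G"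
  proof (rule Int_stableI)
    fix S T assume "S \<in> ?G" "T \<in> ?G"
    then obtain a b a' b' where "S = {a<..b}" "T = {a'<..b'}" by auto
    then have "S \<inter> T = (\<lambda>(a, b). {a<..b}) (max a a', min b b')" by auto
    then show "S \<inter> T \<in> ?G" by blast
  qed
  moreover have "?G \<subseteq> Pow UNIV" by simp
  ultimately show ?thesis
    using B
  proof (induction rule: sigma_sets_induct_disjoint)
    case (basic S)
    then obtain a b where S: "S = {a<..b}" by auto
    have "(\<integral>x. indicator (S \<inter> {-c..c}) x *\<^sub>R cis (t * x) \<partial>lborel) =
        (\<integral>x. indicator {max a (-c)..min b c} x *\<^sub>R cis (t * x) \<partial>lborel)" for t
    proof (rule integral_cong_AE)
      \<comment> \<open>The two sets differ at most in the point \<open>a\<close>.\<close>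
      show "AE x in lborel. indicator (S \<inter> {-c..c}) x *\<^sub>R cis (t * x) =
          indicator {max a (-c)..min b c} x *\<^sub>R cis (t * x)"
        using AE_lborel_singleton[of a]
        by eventually_elim (auto simp: S split: split_indicator)
    qed (use borel_measurable_cis in \<open>auto simp: S intro!: borel_measurable_scaleR\<close>)
    then show ?case
      using integral_cis_interval_tendsto[of "max a (-c)" "min b c"] by simp
  next
    case empty
    then show ?case by simp
  next
    case (compl S)
    have "(\<integral>x. indicator ((UNIV - S) \<inter> {-c..c}) x *\<^sub>R cis (t * x) \<partial>lborel) =
        (\<integral>x. indicator {-c..c} x *\<^sub>R cis (t * x) \<partial>lborel) -
        (\<integral>x. indicator (S \<inter> {-c..c}) x *\<^sub>R cis (t * x) \<partial>lborel)" for t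
      using int[of UNIV] int[OF meas[OF compl(1)]]
      by (subst Bochner_Integration.integral_diff[symmetric])
         (auto intro!: integrable_scaleR_cis Bochner_Integration.integral_cong split: split_indicator)
    then show ?case
      using tendsto_diff[OF integral_cis_interval_tendsto[of "-c" c] compl(2)] by simp
  next
    case (union S)
    have Sb: "S i \<in> sets borel" for i using union(2) meas by auto
    define s where "s n = (\<lambda>x. \<Sum>i<n. indicator (S i \<inter> {-c..c}) x :: real)" for n :: nat
    have s: "s n = indicator ((\<Union>i<n. S i) \<inter> {-c..c})" for n
    proof
      fix x
      have "(\<Union>i<n. S i) \<inter> {-c..c} = (\<Union>i<n. S i \<inter> {-c..c})" by auto
      then show "s n x = indicator ((\<Union>i<n. S i) \<inter> {-c..c}) x"
        unfolding s_def using union(1)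
        by (simp only:) (subst indicator_UN_disjoint, auto simp: disjoint_family_on_def)
    qed
    show ?case
    proof (rule integral_cis_L1_tendsto[where s = s and w = "indicator {-c..c}"])
      show "integrable lborel (s i)" for i
        unfolding s by (rule int) (use Sb in auto)
      show "((\<lambda>t. \<integral>x. s i x *\<^sub>R cis (t * x) \<partial>lborel) \<longlongrightarrow> 0) at_top" for i
      proof -
        have "(\<integral>x. s i x *\<^sub>R cis (t * x) \<partial>lborel) =
            (\<Sum>j<i. \<integral>x. indicator (S j \<inter> {-c..c}) x *\<^sub>R cis (t * x) \<partial>lborel)" for t
          unfolding s_def scaleR_sum_left
          by (rule Bochner_Integration.integral_sum) (intro integrable_scaleR_cis int Sb)
        then show ?thesis
          using tendsto_sum[of "{..<i}", OF union(3)] by simp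
      qed
      show "(\<lambda>i. s i x) \<longlonglongrightarrow> indicator (\<Union> (range S) \<inter> {-c..c}) x" for x
      proof (cases "x \<in> \<Union> (range S)")
        case True
        then obtain k where k: "x \<in> S k" by auto
        have "\<forall>\<^sub>F i in sequentially. s i x = indicator (\<Union> (range S) \<inter> {-c..c}) x"
          using eventually_gt_at_top[of k]
          by eventually_elim (use k in \<open>auto simp: s split: split_indicator\<close>)
        then show ?thesis by (rule tendsto_eventually)
      next
        case False
        then show ?thesis by (auto simp: s)
      qed
      show "\<bar>s i x\<bar> \<le> indicator {-c..c} x" for i x
        by (auto simp: s split: split_indicator)
    qed (use int[of UNIV] int[of "\<Union>(range S)"] Sb in auto)
  qed
qed

text \<open>
  Integrable functions are \<open>L\<^sup>1\<close> limits of simple functions, and a set of finite measure is the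
  limit of its bounded parts.
\<close>

lemma Riemann_Lebesgue:
  fixes f :: "real \<Rightarrow> real"
  assumes "integrable lborel f"
  shows "((\<lambda>t. \<integral>x. f x *\<^sub>R cis (t * x) \<partial>lborel) \<longlongrightarrow> 0) at_top"
  using assms
proof (induction rule: integrable_induct)
  case (base S c)
  have S: "S \<in> sets borel" using base by simp
  have "((\<lambda>t. \<integral>x. indicator S x *\<^sub>R cis (t * x) \<partial>lborel) \<longlongrightarrow> 0) at_top"
  proof (rule integral_cis_L1_tendsto[where s = "\<lambda>n. indicator (S \<inter> {-real n..real n})" and w = "indicator S"])
    show "((\<lambda>t. \<integral>x. indicator (S \<inter> {- real i..real i}) x *\<^sub>R cis (t * x) \<partial>lborel) \<longlongrightarrow> 0) at_top" for i
      by (rule integral_cis_bounded_borel_set_tendsto[OF S])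
    show "integrable lborel (indicator (S \<inter> {-real i..real i}) :: real \<Rightarrow> real)" for i
      using base S emeasure_mono[of "S \<inter> {-real i..real i}" S lborel]
      by (intro integrable_real_indicator) (auto simp: le_less_trans)
    show "(\<lambda>i. indicator (S \<inter> {-real i..real i}) x) \<longlonglongrightarrow> (indicator S x :: real)" for x
    proof (rule tendsto_eventually)
      obtain k :: nat where "\<bar>x\<bar> \<le> real k" using real_arch_simple by blast
      then show "\<forall>\<^sub>F i in sequentially. indicator (S \<inter> {-real i..real i}) x = (indicator S x :: real)"
        by (intro eventually_sequentiallyI[of k]) (auto split: split_indicator)
    qed
  qed (use base in \<open>auto split: split_indicator\<close>)
  from tendsto_scaleR[OF tendsto_const[of c] this] show ?case
    by (simp add: mult.commute flip: scaleR_scaleR)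
next
  case (add f g)
  show ?case
    using tendsto_add[OF add(3,4)] add(1,2) by (simp add: scaleR_add_left integrable_scaleR_cis)
next
  case (lim f s)
  show ?case
    by (rule integral_cis_L1_tendsto[where s = s and w = "\<lambda>x. 2 * \<bar>f x\<bar>"]) (use lim in auto)
qed

lemma Riemann_Lebesgue_measure:
  fixes \<mu> :: "real measure"
  assumes "finite_measure \<mu>" and "sets \<mu> = sets borel" and ac: "absolutely_continuous lborel \<mu>"
  shows "((\<lambda>t. \<integral>x. cis (t * x) \<partial>\<mu>) \<longlongrightarrow> 0) at_top"
proof -
  interpret finite_measure \<mu> by fact
  obtain D where D: "D \<in> borel_measurable lborel" "AE x in lborel. RN_deriv lborel \<mu> x = ennreal (D x)"
    "\<And>x. 0 \<le> D x"
    by (rule sigma_finite_measure.real_RN_deriv[OF sigma_finite_lborel, of \<mu>]) (use assms in auto)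
  have "density lborel (RN_deriv lborel \<mu>) = \<mu>"
    by (rule sigma_finite_measure.density_RN_deriv[OF sigma_finite_lborel ac]) (simp add: assms)
  moreover have "density lborel (RN_deriv lborel \<mu>) = density lborel D"
    using D by (intro density_cong) auto
  ultimately have mu: "\<mu> = density lborel D" by simp
  have "integrable \<mu> (\<lambda>x. 1 :: real)" by simp
  then have "integrable lborel D"
    unfolding mu by (subst (asm) integrable_density) (use D in auto)
  moreover have "(\<integral>x. cis (t * x) \<partial>\<mu>) = (\<integral>x. D x *\<^sub>R cis (t * x) \<partial>lborel)" for t
    unfolding mu
    by (rule integral_density)
       (use D in \<open>auto intro!: borel_measurable_continuous_onI continuous_intros\<close>)
  ultimately show ?thesis using Riemann_Lebesgue[of D] by simp
qed

section \<open>Addition of exponents in exponential series\<close>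

text \<open>
  This is \<open>e\<^sup>z e\<^sup>w = e\<^sup>z\<^sup>+\<^sup>w\<close> applied to matrix elements \<open>b n\<close> of powers of an operator: the double series
  converges absolutely, being dominated by a product of two exponential series, and summation
  along the antidiagonals gives the binomial theorem.
\<close>

lemma exponential_series_add:
  fixes b r :: "nat \<Rightarrow> complex" and z w S :: complex
  assumes b: "\<And>n. norm (b n) \<le> M * C ^ n" and C: "0 \<le> C" and M: "0 \<le> M"
    and inner: "\<And>k. (\<lambda>j. w ^ j / fact j * b (k + j)) sums r k"
    and outer: "(\<lambda>k. z ^ k / fact k * r k) sums S"
  shows "(\<lambda>n. (z + w) ^ n / fact n * b n) sums S"
proof -
  define F where "F = (\<lambda>(k, j). z ^ k / fact k * (w ^ j / fact j * b (k + j)))"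
  define g where "g = (\<lambda>(k, j). M * ((norm z * C) ^ k / fact k) * ((norm w * C) ^ j / fact j))"
  have exp_sums: "(\<lambda>k. x ^ k / fact k) sums exp x" for x :: real
    using exp_converges[of x] by (simp add: field_simps)
  have exp_has_sum: "((\<lambda>k. x ^ k / fact k) has_sum exp x) UNIV" if "x \<ge> 0" for x :: real
    by (rule sums_nonneg_imp_has_sum[OF exp_sums]) (use that in simp)
  have "g summable_on (UNIV \<times> UNIV)"
  proof (rule summable_on_SigmaI)
    show "((\<lambda>y. g (x, y)) has_sum (M * ((norm z * C) ^ x / fact x)) * exp (norm w * C)) UNIV" for x
      unfolding g_def case_prod_conv by (intro has_sum_cmult_right exp_has_sum) (use C in simp)
    have "(\<lambda>x. M * ((norm z * C) ^ x / fact x)) summable_on UNIV"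
      by (intro summable_on_cmult_right has_sum_imp_summable[OF exp_has_sum]) (use C in simp)
    then show "(\<lambda>x. M * ((norm z * C) ^ x / fact x) * exp (norm w * C)) summable_on UNIV"
      by (rule summable_on_cmult_left)
  qed (use C M in \<open>auto simp: g_def\<close>)
  moreover have "norm (F p) \<le> g p" for p
  proof (cases p)
    case (Pair k j)
    have "norm (F p) = norm z ^ k / fact k * (norm w ^ j / fact j) * norm (b (k + j))"
      by (simp add: F_def Pair norm_mult norm_divide norm_power)
    also have "\<dots> \<le> norm z ^ k / fact k * (norm w ^ j / fact j) * (M * C ^ (k + j))"
      by (intro mult_left_mono b) simp
    also have "\<dots> = g p"
      by (simp add: g_def Pair power_mult_distrib power_add)
    finally show ?thesis .
  qed
  ultimately have F_abs: "(\<lambda>p. norm (F p)) summable_on (UNIV \<times> UNIV)"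
    by (rule Infinite_Sum.abs_summable_on_comparison_test'[where g = g])
  then have F_sum: "(F has_sum infsum F (UNIV \<times> UNIV)) (UNIV \<times> UNIV)"
    by (rule has_sum_infsum[OF Infinite_Sum.abs_summable_summable])
  have "((\<lambda>k. z ^ k / fact k * r k) has_sum infsum F (UNIV \<times> UNIV)) UNIV"
  proof (rule has_sum_SigmaD[OF F_sum])
    fix k
    have "(\<lambda>j. norm (F (k, j))) summable_on UNIV"
      using F_abs unfolding Infinite_Sum.abs_summable_on_Sigma_iff by auto
    then have "summable (\<lambda>j. norm (F (k, j)))"
      by (rule summable_on_imp_summable)
    moreover have "(\<lambda>j. F (k, j)) sums (z ^ k / fact k * r k)"
      unfolding F_def case_prod_conv by (intro sums_mult inner)
    ultimately show "((\<lambda>j. F (k, j)) has_sum z ^ k / fact k * r k) UNIV"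
      by (rule norm_summable_imp_has_sum)
  qed
  then have S: "infsum F (UNIV \<times> UNIV) = S"
    using has_sum_imp_sums sums_unique2 outer by blast
  have "((\<lambda>(n, k). F (k, n - k)) has_sum S) (SIGMA n:UNIV. {..n}) \<longleftrightarrow> (F has_sum S) (UNIV \<times> UNIV)"
    by (rule has_sum_reindex_bij_witness[where i = "\<lambda>(k, j). (k + j, k)" and j = "\<lambda>(n, k). (k, n - k)"])
       auto
  then have "((\<lambda>(n, k). F (k, n - k)) has_sum S) (SIGMA n:UNIV. {..n})"
    using F_sum S by simp
  then have "((\<lambda>n. (z + w) ^ n / fact n * b n) has_sum S) UNIV"
  proof (rule has_sum_SigmaD)
    fix n
    have "(z + w) ^ n / fact n * b n = (\<Sum>k\<le>n. F (k, n - k))"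
      unfolding binomial_ring sum_divide_distrib sum_distrib_right
      by (intro sum.cong refl) (auto simp: F_def binomial_fact)
    then show "((\<lambda>y. (\<lambda>(n, k). F (k, n - k)) (n, y)) has_sum (z + w) ^ n / fact n * b n) {..n}"
      by simp
  qed
  then show ?thesis by (rule has_sum_imp_sums)
qed

section \<open>Geometry of a Hilbert space given by a carrier\<close>

context complex_hilbert_space
begin

lemma zero_vecs [simp]: "0 \<in> vecs K" by (rule subspace_0[OF subspace_vecs])
lemma add_vecs [simp]: "x \<in> vecs K \<Longrightarrow> y \<in> vecs K \<Longrightarrow> x + y \<in> vecs K"
  by (rule subspace_add[OF subspace_vecs])
lemma diff_vecs [simp]: "x \<in> vecs K \<Longrightarrow> y \<in> vecs K \<Longrightarrow> x - y \<in> vecs K"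
  by (rule subspace_diff[OF subspace_vecs])
lemma scl_vecs [simp]: "x \<in> vecs K \<Longrightarrow> scl K c x \<in> vecs K"
  by (rule subspace_scale[OF subspace_vecs])
lemma sum_vecs [simp]: "(\<And>i. i \<in> I \<Longrightarrow> f i \<in> vecs K) \<Longrightarrow> sum f I \<in> vecs K"
  by (rule subspace_sum[OF subspace_vecs])

lemma ip_zero_left [simp]: "y \<in> vecs K \<Longrightarrow> ip K 0 y = 0"
  using ip_scl_left[of 0 y 0] by simp

lemma ip_zero_right [simp]: "y \<in> vecs K \<Longrightarrow> ip K y 0 = 0"
  using ip_cnj[of 0 y] by simp

lemma ip_add_right:
  "\<lbrakk>x \<in> vecs K; y \<in> vecs K; z \<in> vecs K\<rbrakk> \<Longrightarrow> ip K x (y + z) = ip K x y + ip K x z"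
  using ip_cnj[of "y + z" x] ip_cnj[of y x] ip_cnj[of z x] by (simp add: ip_add_left)

lemma ip_scl_right: "\<lbrakk>x \<in> vecs K; y \<in> vecs K\<rbrakk> \<Longrightarrow> ip K x (scl K c y) = cnj c * ip K x y"
  using ip_cnj[of "scl K c y" x] ip_cnj[of y x] by (simp add: ip_scl_left)

lemma ip_diff_left:
  "\<lbrakk>x \<in> vecs K; y \<in> vecs K; z \<in> vecs K\<rbrakk> \<Longrightarrow> ip K (x - y) z = ip K x z - ip K y z"
  using ip_add_left[of "x - y" y z] by simp

lemma ip_diff_right:
  "\<lbrakk>x \<in> vecs K; y \<in> vecs K; z \<in> vecs K\<rbrakk> \<Longrightarrow> ip K x (y - z) = ip K x y - ip K x z"
  using ip_add_right[of x "y - z" z] by simp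

lemma ip_sum_left:
  "\<lbrakk>\<And>i. i \<in> I \<Longrightarrow> f i \<in> vecs K; y \<in> vecs K\<rbrakk> \<Longrightarrow> ip K (sum f I) y = (\<Sum>i\<in>I. ip K (f i) y)"
  by (induction I rule: infinite_finite_induct) (simp_all add: ip_add_left)

lemma Re_ip_self_nonneg: "x \<in> vecs K \<Longrightarrow> 0 \<le> Re (ip K x x)"
  using ip_pos[of x] by (cases "x = 0") auto

lemma ip_self: "x \<in> vecs K \<Longrightarrow> ip K x x = of_real ((hnorm K x)\<^sup>2)"
  using ip_cnj[of x x] Re_ip_self_nonneg[of x] by (simp add: hnorm_def complex_eq_iff)

lemma hnorm_nonneg [simp]: "x \<in> vecs K \<Longrightarrow> 0 \<le> hnorm K x"
  by (simp add: hnorm_def Re_ip_self_nonneg)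

lemma hnorm_zero [simp]: "hnorm K 0 = 0"
  by (simp add: hnorm_def)

lemma hnorm_eq_zero: "x \<in> vecs K \<Longrightarrow> hnorm K x = 0 \<longleftrightarrow> x = 0"
  using ip_pos[of x] by (cases "x = 0") (auto simp: hnorm_def)

lemma Cauchy_Schwarz:
  assumes [simp]: "x \<in> vecs K" "y \<in> vecs K"
  shows "norm (ip K x y) \<le> hnorm K x * hnorm K y"
proof (cases "y = 0")
  case False
  let ?n = "(hnorm K y)\<^sup>2"
  have n: "?n > 0" using False hnorm_eq_zero[of y] by simp
  \<comment> \<open>Then \<open>c y\<close> is the orthogonal projection of \<open>x\<close> onto the line through \<open>y\<close>.\<close>
  define c where "c = ip K x y / ?n"
  have "ip K (x - scl K c y) (x - scl K c y) =
      ip K x x - cnj c * ip K x y - c * ip K y x + c * cnj c * ip K y y"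
    by (simp add: ip_diff_left ip_diff_right ip_scl_left ip_scl_right algebra_simps)
  also have "\<dots> = (hnorm K x)\<^sup>2 - ip K x y * cnj (ip K x y) / ?n"
    using n ip_cnj[of x y] by (simp add: c_def ip_self field_simps power2_eq_square)
  also have "\<dots> = of_real ((hnorm K x)\<^sup>2 - (norm (ip K x y))\<^sup>2 / ?n)"
    by (simp add: complex_norm_square[symmetric])
  finally have "0 \<le> (hnorm K x)\<^sup>2 - (norm (ip K x y))\<^sup>2 / ?n"
    using Re_ip_self_nonneg[of "x - scl K c y"] by simp
  then have "(norm (ip K x y))\<^sup>2 \<le> (hnorm K x * hnorm K y)\<^sup>2"
    using n by (simp add: field_simps power_mult_distrib)
  then show ?thesis by (rule power2_le_imp_le) simp
qed simp

lemma hnorm_add_square: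
  assumes [simp]: "x \<in> vecs K" "y \<in> vecs K"
  shows "(hnorm K (x + y))\<^sup>2 = (hnorm K x)\<^sup>2 + 2 * Re (ip K x y) + (hnorm K y)\<^sup>2"
proof -
  have "of_real ((hnorm K (x + y))\<^sup>2) = ip K (x + y) (x + y)" by (simp add: ip_self)
  also have "\<dots> = of_real ((hnorm K x)\<^sup>2) + (ip K x y + cnj (ip K x y)) + of_real ((hnorm K y)\<^sup>2)"
    using ip_cnj[of x y] unfolding ip_self[OF assms(1), symmetric] ip_self[OF assms(2), symmetric]
    by (simp add: ip_add_left ip_add_right)
  also have "\<dots> = of_real ((hnorm K x)\<^sup>2 + 2 * Re (ip K x y) + (hnorm K y)\<^sup>2)"
    by (simp add: complex_add_cnj)
  finally show ?thesis using of_real_eq_iff by blast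
qed

lemma hnorm_triangle:
  assumes [simp]: "x \<in> vecs K" "y \<in> vecs K"
  shows "hnorm K (x + y) \<le> hnorm K x + hnorm K y"
proof (rule power2_le_imp_le)
  have "Re (ip K x y) \<le> hnorm K x * hnorm K y"
    using Cauchy_Schwarz[of x y] complex_Re_le_cmod[of "ip K x y"] by simp
  then show "(hnorm K (x + y))\<^sup>2 \<le> (hnorm K x + hnorm K y)\<^sup>2"
    by (simp add: hnorm_add_square power2_sum)
qed simp

lemma hnorm_scl:
  assumes [simp]: "x \<in> vecs K"
  shows "hnorm K (scl K c x) = norm c * hnorm K x"
proof -
  have "ip K (scl K c x) (scl K c x) = (c * cnj c) * ip K x x"
    by (simp add: ip_scl_left ip_scl_right)
  also have "\<dots> = of_real ((norm c * hnorm K x)\<^sup>2)"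
    by (simp add: ip_self complex_norm_square[symmetric] power_mult_distrib)
  finally have "(hnorm K (scl K c x))\<^sup>2 = (norm c * hnorm K x)\<^sup>2"
    unfolding ip_self[OF scl_vecs[OF assms]] using of_real_eq_iff by blast
  then show ?thesis by (simp add: power2_eq_iff_nonneg)
qed

lemma hnorm_diff_commute:
  assumes [simp]: "x \<in> vecs K" "y \<in> vecs K"
  shows "hnorm K (x - y) = hnorm K (y - x)"
  using hnorm_scl[of "y - x" "-1"] by simp

lemma hnorm_sum:
  "(\<And>i. i \<in> I \<Longrightarrow> f i \<in> vecs K) \<Longrightarrow> hnorm K (sum f I) \<le> (\<Sum>i\<in>I. hnorm K (f i))"
  by (induction I rule: infinite_finite_induct) (auto intro: order_trans[OF hnorm_triangle])

lemma hlimit_unique: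
  assumes X: "\<And>n. X n \<in> vecs K" and x: "hlimit K X x" and y: "hlimit K X y"
  shows "x = y"
proof -
  have [simp]: "x \<in> vecs K" "y \<in> vecs K" using x y by (auto simp: hlimit_def)
  have "(\<lambda>n. hnorm K (X n - x) + hnorm K (X n - y)) \<longlonglongrightarrow> 0 + 0"
    using x y unfolding hlimit_def by (intro tendsto_add) auto
  moreover have "hnorm K (x - y) \<le> hnorm K (X n - x) + hnorm K (X n - y)" for n
    using hnorm_triangle[of "x - X n" "X n - y"] hnorm_diff_commute[of x "X n"] X by simp
  ultimately have "hnorm K (x - y) \<le> 0"
    by (intro LIMSEQ_le_const) auto
  then have "hnorm K (x - y) = 0" by (intro antisym) simp_all
  then show ?thesis by (simp add: hnorm_eq_zero)
qed

lemma hlimit_ip: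
  assumes X: "\<And>n. X n \<in> vecs K" and x: "hlimit K X x" and y: "y \<in> vecs K"
  shows "(\<lambda>n. ip K (X n) y) \<longlonglongrightarrow> ip K x y"
proof -
  have [simp]: "x \<in> vecs K" using x by (auto simp: hlimit_def)
  have "(\<lambda>n. ip K (X n) y - ip K x y) \<longlonglongrightarrow> 0"
  proof (rule Lim_null_comparison)
    show "\<forall>\<^sub>F n in sequentially. norm (ip K (X n) y - ip K x y) \<le> hnorm K (X n - x) * hnorm K y"
      using Cauchy_Schwarz[of "X _ - x" y] X y by (intro always_eventually) (simp add: ip_diff_left)
    show "(\<lambda>n. hnorm K (X n - x) * hnorm K y) \<longlonglongrightarrow> 0"
      using x by (intro tendsto_mult_left_zero) (simp add: hlimit_def)
  qed
  then show ?thesis by (rule LIM_zero_cancel)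
qed

text \<open>
  The Weierstrass test, which gives the convergence of the exponential series.
\<close>

lemma hcauchy_sums:
  assumes f: "\<And>k. f k \<in> vecs K" and b: "\<And>k. hnorm K (f k) \<le> b k" and "summable b"
  shows "hcauchy K (\<lambda>n. \<Sum>k<n. f k)"
  unfolding hcauchy_def
proof (intro allI impI)
  fix e :: real assume "e > 0"
  then obtain M where M: "\<And>m n. M \<le> m \<Longrightarrow> norm (sum b {m..<n}) < e"
    using \<open>summable b\<close> unfolding summable_Cauchy by meson
  have le: "hnorm K ((\<Sum>k<n. f k) - (\<Sum>k<m. f k)) < e" if "M \<le> m" "m \<le> n" for m n
  proof -
    have "(\<Sum>k<n. f k) - (\<Sum>k<m. f k) = (\<Sum>k\<in>{m..<n}. f k)"
      using sum_diff_nat_ivl[of 0 m n f] that by (simp add: lessThan_atLeast0)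
    also have "hnorm K \<dots> \<le> (\<Sum>k\<in>{m..<n}. b k)"
      using f b by (intro order_trans[OF hnorm_sum] sum_mono)
    also have "\<dots> < e" using M[of m n] that by simp
    finally show ?thesis .
  qed
  have "hnorm K ((\<Sum>k<m. f k) - (\<Sum>k<n. f k)) < e" if "M \<le> m" "M \<le> n" for m n
  proof (cases "m \<le> n")
    case True
    have "hnorm K ((\<Sum>k<m. f k) - (\<Sum>k<n. f k)) = hnorm K ((\<Sum>k<n. f k) - (\<Sum>k<m. f k))"
      by (intro hnorm_diff_commute sum_vecs f)
    then show ?thesis using le[OF that(1) True] by simp
  next
    case False
    then show ?thesis using le[OF that(2)] by simp
  qed
  then show "\<exists>M. \<forall>m\<ge>M. \<forall>n\<ge>M. hnorm K ((\<Sum>k<m. f k) - (\<Sum>k<n. f k)) < e"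
    by blast
qed

section \<open>Weak convergence of almost orthogonal families\<close>

text \<open>
  Suppose that \<open>\<bar>\<langle>v t, \<phi>\<rangle>\<bar> \<ge> e\<close> at arbitrarily late times.  Adding up such vectors, each chosen so late
  that it is almost orthogonal to the sum so far and rotated to correlate positively with \<open>\<phi>\<close>,
  yields sums \<open>w\<close> of \<open>m\<close> vectors with \<open>\<parallel>w\<parallel>\<^sup>2\<close> at most linear in \<open>m\<close> and \<open>Re \<langle>w, \<phi>\<rangle> \<ge> m e\<close>.
  For large \<open>m\<close> this contradicts the Cauchy-Schwarz inequality.
\<close>

lemma weakly_null:
  fixes v :: "real \<Rightarrow> 'v"
  assumes v: "\<And>t. v t \<in> vecs K" and R: "\<And>t. hnorm K (v t) \<le> R"
    and corr: "\<And>s. ((\<lambda>t. ip K (v t) (v s)) \<longlongrightarrow> 0) at_top"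
    and phi: "\<phi> \<in> vecs K"
  shows "((\<lambda>t. ip K (v t) \<phi>) \<longlongrightarrow> 0) at_top"
proof (rule ccontr)
  assume "\<not> ?thesis"
  then obtain e where e: "e > 0" and "\<not> (\<forall>\<^sub>F t in at_top. norm (ip K (v t) \<phi>) < e)"
    unfolding tendsto_iff by auto
  then have freq: "\<exists>\<^sub>F t in at_top. norm (ip K (v t) \<phi>) \<ge> e"
    by (simp add: not_eventually not_less)
  have "\<exists>w\<in>vecs K. ((\<lambda>t. ip K (v t) w) \<longlongrightarrow> 0) at_top \<and>
      (hnorm K w)\<^sup>2 \<le> m * (R\<^sup>2 + 2) \<and> Re (ip K w \<phi>) \<ge> m * e" for m :: nat
  proof (induction m)
    case 0
    then show ?case by (intro bexI[of _ 0]) (simp_all add: v phi)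
  next
    case (Suc m)
    then obtain w where w [simp]: "w \<in> vecs K" and null: "((\<lambda>t. ip K (v t) w) \<longlongrightarrow> 0) at_top"
      and wn: "(hnorm K w)\<^sup>2 \<le> m * (R\<^sup>2 + 2)" and wp: "Re (ip K w \<phi>) \<ge> m * e"
      by blast
    have "\<forall>\<^sub>F t in at_top. norm (ip K (v t) w) < 1"
      using tendstoD[OF null, of 1] by simp
    then have "\<exists>\<^sub>F t in at_top. norm (ip K (v t) w) < 1 \<and> e \<le> norm (ip K (v t) \<phi>)"
      by (intro frequently_rev_mp[OF freq]) (auto elim: eventually_mono)
    then obtain t where t: "norm (ip K (v t) w) < 1" "e \<le> norm (ip K (v t) \<phi>)"
      by (blast dest: frequently_ex)
    \<comment> \<open>The phase that makes \<open>\<langle>c v, \<phi>\<rangle>\<close> equal to its modulus, at least \<open>e\<close>.\<close>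
    define c where "c = cnj (sgn (ip K (v t) \<phi>))"
    have c: "c * ip K (v t) \<phi> = of_real (norm (ip K (v t) \<phi>))" "norm c = 1"
    proof -
      have nz: "ip K (v t) \<phi> \<noteq> 0" using t(2) e by auto
      then show "norm c = 1" by (simp add: c_def norm_sgn)
      have "c * ip K (v t) \<phi> = (of_real (norm (ip K (v t) \<phi>)))\<^sup>2 / of_real (norm (ip K (v t) \<phi>))"
        using complex_norm_square[of "ip K (v t) \<phi>"] by (simp add: c_def sgn_eq mult.commute)
      then show "c * ip K (v t) \<phi> = of_real (norm (ip K (v t) \<phi>))"
        using nz by (simp add: power2_eq_square)
    qed
    have vt [simp]: "v t \<in> vecs K" by (rule v)
    show ?case
    proof (intro bexI[of _ "w + scl K c (v t)"] conjI)
      have "((\<lambda>s. ip K (v s) w + cnj c * ip K (v s) (v t)) \<longlongrightarrow> 0 + cnj c * 0) at_top"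
        by (intro tendsto_intros null corr)
      then show "((\<lambda>s. ip K (v s) (w + scl K c (v t))) \<longlongrightarrow> 0) at_top"
        by (simp add: ip_add_right ip_scl_right v)
      have "norm (ip K w (scl K c (v t))) = norm (ip K (v t) w)"
        using ip_cnj[of "v t" w] c by (simp add: ip_scl_right norm_mult)
      then have "Re (ip K w (scl K c (v t))) \<le> 1"
        using t complex_Re_le_cmod[of "ip K w (scl K c (v t))"] by simp
      moreover have "(hnorm K (scl K c (v t)))\<^sup>2 \<le> R\<^sup>2"
        using R[of t] c by (intro power_mono) (simp_all add: hnorm_scl)
      ultimately show "(hnorm K (w + scl K c (v t)))\<^sup>2 \<le> Suc m * (R\<^sup>2 + 2)"
        using wn by (simp add: hnorm_add_square algebra_simps)
      show "Re (ip K (w + scl K c (v t)) \<phi>) \<ge> Suc m * e"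
        using wp t(2) c phi by (simp add: ip_add_left ip_scl_left algebra_simps)
    qed simp
  qed
  note approx = this
  have bound: "(m * e)\<^sup>2 \<le> m * (R\<^sup>2 + 2) * (hnorm K \<phi>)\<^sup>2" for m :: nat
  proof -
    obtain w where w: "w \<in> vecs K" "(hnorm K w)\<^sup>2 \<le> m * (R\<^sup>2 + 2)" "Re (ip K w \<phi>) \<ge> m * e"
      using approx[of m] by blast
    have "m * e \<le> hnorm K w * hnorm K \<phi>"
      using w(3) complex_Re_le_cmod[of "ip K w \<phi>"] Cauchy_Schwarz[OF w(1) phi] by linarith
    then have "(m * e)\<^sup>2 \<le> (hnorm K w * hnorm K \<phi>)\<^sup>2"
      using e by (intro power_mono) auto
    also have "\<dots> \<le> m * (R\<^sup>2 + 2) * (hnorm K \<phi>)\<^sup>2"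
      unfolding power_mult_distrib by (intro mult_right_mono w) simp
    finally show ?thesis .
  qed
  obtain m :: nat where m: "real m > (R\<^sup>2 + 2) * (hnorm K \<phi>)\<^sup>2 / e\<^sup>2"
    using reals_Archimedean2 by blast
  moreover have "(R\<^sup>2 + 2) * (hnorm K \<phi>)\<^sup>2 / e\<^sup>2 \<ge> 0" by simp
  ultimately have "real m > 0" by linarith
  then have "m * e\<^sup>2 \<le> (R\<^sup>2 + 2) * (hnorm K \<phi>)\<^sup>2"
  proof -
    have "m * (m * e\<^sup>2) \<le> m * ((R\<^sup>2 + 2) * (hnorm K \<phi>)\<^sup>2)"
      using bound[of m] by (simp only: power_mult_distrib power2_eq_square mult_ac)
    then show ?thesis using \<open>real m > 0\<close> by (simp only: mult_le_cancel_left_pos)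
  qed
  then have "m \<le> (R\<^sup>2 + 2) * (hnorm K \<phi>)\<^sup>2 / e\<^sup>2"
    using e by (simp add: pos_le_divide_eq)
  with m show False by simp
qed

section \<open>Bounded operators and their powers\<close>

lemma bounded_operator_id: "bounded_operator K (\<lambda>x. x)"
  unfolding bounded_operator_def by (auto intro!: exI[of _ 1])

lemma bounded_operator_vecs: "bounded_operator K A \<Longrightarrow> x \<in> vecs K \<Longrightarrow> A x \<in> vecs K"
  by (simp add: bounded_operator_def)

lemma bounded_operator_bound:
  assumes "bounded_operator K A"
  obtains C where "C \<ge> 1" "\<And>x. x \<in> vecs K \<Longrightarrow> hnorm K (A x) \<le> C * hnorm K x"
proof -
  obtain C where C: "\<And>x. x \<in> vecs K \<Longrightarrow> hnorm K (A x) \<le> C * hnorm K x"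
    using assms unfolding bounded_operator_def by blast
  have "hnorm K (A x) \<le> max 1 C * hnorm K x" if "x \<in> vecs K" for x
    using C[OF that] by (rule order_trans) (intro mult_right_mono, use that in auto)
  then show ?thesis by (intro that[of "max 1 C"]) auto
qed

lemma bounded_operator_comp:
  assumes A: "bounded_operator K A" and B: "bounded_operator K B"
  shows "bounded_operator K (\<lambda>x. A (B x))"
proof -
  obtain C D where C: "C \<ge> 1" "\<And>x. x \<in> vecs K \<Longrightarrow> hnorm K (A x) \<le> C * hnorm K x"
    and D: "D \<ge> 1" "\<And>x. x \<in> vecs K \<Longrightarrow> hnorm K (B x) \<le> D * hnorm K x"
    using bounded_operator_bound[OF A] bounded_operator_bound[OF B] by metis
  have "hnorm K (A (B x)) \<le> (C * D) * hnorm K x" if "x \<in> vecs K" for x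
  proof -
    have "hnorm K (A (B x)) \<le> C * hnorm K (B x)"
      using that B by (intro C) (simp add: bounded_operator_def)
    also have "\<dots> \<le> C * (D * hnorm K x)"
      using that C(1) by (intro mult_left_mono D) auto
    finally show ?thesis by simp
  qed
  then show ?thesis using A B unfolding bounded_operator_def by auto
qed

lemma bounded_operator_pow:
  assumes "bounded_operator K A"
  shows "bounded_operator K (A ^^ k)"
proof (induction k)
  case 0
  then show ?case using bounded_operator_id by (simp add: id_def)
next
  case (Suc k)
  then show ?case using bounded_operator_comp[OF assms Suc] by (simp add: o_def)
qed

lemma bounded_operator_scl:
  assumes "bounded_operator K A"
  shows "bounded_operator K (\<lambda>x. scl K c (A x))"
proof -
  obtain C where C: "\<And>x. x \<in> vecs K \<Longrightarrow> hnorm K (A x) \<le> C * hnorm K x"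
    using bounded_operator_bound[OF assms] by metis
  have "hnorm K (scl K c (A x)) \<le> (norm c * C) * hnorm K x" if "x \<in> vecs K" for x
    using C[OF that] that assms
    by (simp add: hnorm_scl bounded_operator_vecs mult.assoc mult_left_mono)
  then show ?thesis
    using assms unfolding bounded_operator_def by (auto simp: scale_right_distrib scale_left_commute)
qed

lemma bounded_operator_add:
  assumes A: "bounded_operator K A" and B: "bounded_operator K B"
  shows "bounded_operator K (\<lambda>x. A x + B x)"
proof -
  obtain C D where C: "\<And>x. x \<in> vecs K \<Longrightarrow> hnorm K (A x) \<le> C * hnorm K x"
    and D: "\<And>x. x \<in> vecs K \<Longrightarrow> hnorm K (B x) \<le> D * hnorm K x"
    using bounded_operator_bound[OF A] bounded_operator_bound[OF B] by metis
  have "hnorm K (A x + B x) \<le> (C + D) * hnorm K x" if "x \<in> vecs K" for x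
    using C[OF that] D[OF that] hnorm_triangle[of "A x" "B x"] that A B
    by (simp add: bounded_operator_vecs algebra_simps)
  then show ?thesis
    using A B unfolding bounded_operator_def by (auto simp: scale_right_distrib add_ac)
qed

lemma bounded_operator_sum:
  "(\<And>i. i \<in> I \<Longrightarrow> bounded_operator K (f i)) \<Longrightarrow> bounded_operator K (\<lambda>x. \<Sum>i\<in>I. f i x)"
proof (induction I rule: infinite_finite_induct)
  case (insert i I)
  then show ?case by (simp add: bounded_operator_add)
qed (auto simp: bounded_operator_def intro: exI[of _ 0])

lemma bounded_operator_diff:
  assumes "bounded_operator K A" "x \<in> vecs K" "y \<in> vecs K"
  shows "A (x - y) = A x - A y"
proof -
  have "A ((x - y) + y) = A (x - y) + A y"
    using assms unfolding bounded_operator_def by (meson diff_vecs)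
  then show ?thesis by simp
qed

lemma hnorm_pow_le:
  assumes "bounded_operator K A" and C: "0 \<le> C" "\<And>x. x \<in> vecs K \<Longrightarrow> hnorm K (A x) \<le> C * hnorm K x"
    and x: "x \<in> vecs K"
  shows "hnorm K ((A ^^ k) x) \<le> C ^ k * hnorm K x"
proof (induction k)
  case (Suc k)
  have "(A ^^ k) x \<in> vecs K" using bounded_operator_vecs[OF bounded_operator_pow] assms by blast
  then have "hnorm K ((A ^^ Suc k) x) \<le> C * hnorm K ((A ^^ k) x)" by (simp add: C)
  also have "\<dots> \<le> C * (C ^ k * hnorm K x)" by (intro mult_left_mono Suc C)
  finally show ?case by simp
qed simp

lemma ip_pow_le:
  assumes "bounded_operator K A" and "0 \<le> C" "\<And>x. x \<in> vecs K \<Longrightarrow> hnorm K (A x) \<le> C * hnorm K x"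
    and x: "x \<in> vecs K" and y: "y \<in> vecs K"
  shows "norm (ip K ((A ^^ k) x) y) \<le> (hnorm K x * hnorm K y) * C ^ k"
proof -
  have "norm (ip K ((A ^^ k) x) y) \<le> hnorm K ((A ^^ k) x) * hnorm K y"
    using bounded_operator_vecs[OF bounded_operator_pow] assms by (intro Cauchy_Schwarz) blast+
  also have "\<dots> \<le> (C ^ k * hnorm K x) * hnorm K y"
    using assms by (intro mult_right_mono hnorm_pow_le) auto
  finally show ?thesis by (simp add: mult_ac)
qed

lemma bounded_operator_sum_distrib:
  assumes A: "bounded_operator K A" and f: "\<And>i. i \<in> I \<Longrightarrow> f i \<in> vecs K"
  shows "A (sum f I) = (\<Sum>i\<in>I. A (f i))"
proof -
  have A0: "A 0 = 0" using bounded_operator_diff[OF A, of 0 0] by simp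
  show ?thesis using f
  proof (induction I rule: infinite_finite_induct)
    case (insert i I)
    then have "A (f i + sum f I) = A (f i) + A (sum f I)"
      using A by (simp add: bounded_operator_def)
    with insert show ?case by simp
  qed (use A0 in simp_all)
qed

section \<open>The unitary group of a bounded self-adjoint operator\<close>

text \<open>
  The limit in the definition of the exponential exists by completeness and is unique, so the
  definite description denotes it.
\<close>

lemma exp_i_op_hlimit:
  assumes A: "bounded_operator K A" and x: "x \<in> vecs K"
  shows "hlimit K (\<lambda>n. \<Sum>k<n. scl K ((\<i> * of_real t) ^ k / fact k) ((A ^^ k) x)) (exp_i_op K A t x)"
proof -
  let ?f = "\<lambda>k. scl K ((\<i> * of_real t) ^ k / fact k) ((A ^^ k) x)"
  obtain C where C: "C \<ge> 1" "\<And>x. x \<in> vecs K \<Longrightarrow> hnorm K (A x) \<le> C * hnorm K x"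
    using bounded_operator_bound[OF A] by metis
  have pow [simp]: "(A ^^ k) x \<in> vecs K" for k
    using bounded_operator_vecs[OF bounded_operator_pow[OF A] x] .
  have vec: "?f k \<in> vecs K" for k by simp
  have "hcauchy K (\<lambda>n. \<Sum>k<n. ?f k)"
  proof (rule hcauchy_sums)
    show "hnorm K (?f k) \<le> (\<bar>t\<bar> * C) ^ k / fact k * hnorm K x" for k
    proof -
      have "hnorm K (?f k) = \<bar>t\<bar> ^ k / fact k * hnorm K ((A ^^ k) x)"
        by (simp add: hnorm_scl norm_mult norm_divide norm_power)
      also have "\<dots> \<le> \<bar>t\<bar> ^ k / fact k * (C ^ k * hnorm K x)"
        using C by (intro mult_left_mono hnorm_pow_le[OF A _ _ x]) auto
      finally show ?thesis by (simp add: power_mult_distrib)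
    qed
    have "summable (\<lambda>k. (\<bar>t\<bar> * C) ^ k / fact k)"
      using summable_exp_generic[of "\<bar>t\<bar> * C"] by (simp add: field_simps)
    then show "summable (\<lambda>k. (\<bar>t\<bar> * C) ^ k / fact k * hnorm K x)" by (rule summable_mult2)
  qed (rule vec)
  then obtain y where y: "hlimit K (\<lambda>n. \<Sum>k<n. ?f k) y"
    using complete_vecs[of "\<lambda>n. \<Sum>k<n. ?f k"] vec by auto
  show ?thesis
    unfolding exp_i_op_def
  proof (rule theI)
    show "hlimit K (\<lambda>n. \<Sum>k<n. ?f k) y" by (rule y)
    show "y' = y" if "hlimit K (\<lambda>n. \<Sum>k<n. ?f k) y'" for y'
      by (rule hlimit_unique[OF _ that y]) (simp add: vec)
  qed
qed

lemma exp_i_op_vecs: "bounded_operator K A \<Longrightarrow> x \<in> vecs K \<Longrightarrow> exp_i_op K A t x \<in> vecs K"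
  using exp_i_op_hlimit unfolding hlimit_def by blast

lemma ip_exp_i_op_sums:
  assumes A: "bounded_operator K A" and x: "x \<in> vecs K" and y: "y \<in> vecs K"
  shows "(\<lambda>k. (\<i> * of_real t) ^ k / fact k * ip K ((A ^^ k) x) y) sums ip K (exp_i_op K A t x) y"
proof -
  have pow [simp]: "(A ^^ k) x \<in> vecs K" for k
    using bounded_operator_vecs[OF bounded_operator_pow[OF A] x] .
  show ?thesis
    using hlimit_ip[OF _ exp_i_op_hlimit[OF A x] y, of t] y
    by (simp add: sums_def ip_sum_left ip_scl_left)
qed

lemma self_adjoint_pow:
  assumes A: "bounded_self_adjoint K A" and x: "x \<in> vecs K" and y: "y \<in> vecs K"
  shows "ip K x ((A ^^ j) y) = ip K ((A ^^ j) x) y"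
  using x
proof (induction j arbitrary: x)
  case (Suc j)
  have B: "bounded_operator K A" using A by (simp add: bounded_self_adjoint_def)
  have "(A ^^ j) y \<in> vecs K" using bounded_operator_vecs[OF bounded_operator_pow[OF B] y] .
  then have "ip K x ((A ^^ Suc j) y) = ip K (A x) ((A ^^ j) y)"
    using A Suc.prems by (simp add: bounded_self_adjoint_def)
  also have "\<dots> = ip K ((A ^^ Suc j) x) y"
    using Suc.IH[of "A x"] bounded_operator_vecs[OF B Suc.prems] by (simp add: funpow_swap1)
  finally show ?case .
qed simp

text \<open>
  Unitarity and the group law in one identity.  Both factors are expanded as series, and
  self-adjointness moves all powers of \<open>A\<close> to the left.
\<close>

lemma ip_exp_i_op_exp_i_op:
  assumes A: "bounded_self_adjoint K A" and x: "x \<in> vecs K" and y: "y \<in> vecs K"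
  shows "ip K (exp_i_op K A t x) (exp_i_op K A s y) = ip K (exp_i_op K A (t - s) x) y"
proof -
  have B: "bounded_operator K A" using A by (simp add: bounded_self_adjoint_def)
  have pow [simp]: "(A ^^ k) x \<in> vecs K" if "x \<in> vecs K" for k x
    using bounded_operator_vecs[OF bounded_operator_pow[OF B] that] .
  have U [simp]: "exp_i_op K A s y \<in> vecs K" by (rule exp_i_op_vecs[OF B y])
  obtain C where C: "C \<ge> 1" "\<And>x. x \<in> vecs K \<Longrightarrow> hnorm K (A x) \<le> C * hnorm K x"
    using bounded_operator_bound[OF B] by metis
  let ?z = "\<i> * complex_of_real t" and ?w = "- (\<i> * complex_of_real s)"
  have inner: "(\<lambda>j. ?w ^ j / fact j * ip K ((A ^^ (k + j)) x) y) sums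
      ip K ((A ^^ k) x) (exp_i_op K A s y)" for k
  proof -
    have "(\<lambda>j. cnj ((\<i> * of_real s) ^ j / fact j * ip K ((A ^^ j) y) ((A ^^ k) x))) sums
        cnj (ip K (exp_i_op K A s y) ((A ^^ k) x))"
      unfolding sums_cnj by (intro ip_exp_i_op_sums B y pow x)
    moreover have "cnj (ip K (exp_i_op K A s y) ((A ^^ k) x)) = ip K ((A ^^ k) x) (exp_i_op K A s y)"
      using x by (simp add: ip_cnj[symmetric])
    moreover have "cnj ((\<i> * of_real s) ^ j / fact j * ip K ((A ^^ j) y) ((A ^^ k) x)) =
        ?w ^ j / fact j * ip K ((A ^^ (k + j)) x) y" for j
    proof -
      have "cnj (ip K ((A ^^ j) y) ((A ^^ k) x)) = ip K ((A ^^ k) x) ((A ^^ j) y)"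
        using x y by (simp add: ip_cnj[symmetric])
      also have "\<dots> = ip K ((A ^^ (k + j)) x) y"
        using self_adjoint_pow[OF A pow[OF x] y, of k j] by (simp add: funpow_add add.commute)
      finally show ?thesis by simp
    qed
    ultimately show ?thesis by (simp only:)
  qed
  have "(\<lambda>n. (?z + ?w) ^ n / fact n * ip K ((A ^^ n) x) y) sums
      ip K (exp_i_op K A t x) (exp_i_op K A s y)"
  proof (rule exponential_series_add[where z = ?z and w = ?w and b = "\<lambda>n. ip K ((A ^^ n) x) y"
        and C = C and M = "hnorm K x * hnorm K y", OF _ _ _ inner])
    show "norm (ip K ((A ^^ n) x) y) \<le> (hnorm K x * hnorm K y) * C ^ n" for n
      using C by (intro ip_pow_le B x y) auto
    show "(\<lambda>k. ?z ^ k / fact k * ip K ((A ^^ k) x) (exp_i_op K A s y)) sums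
        ip K (exp_i_op K A t x) (exp_i_op K A s y)"
      by (intro ip_exp_i_op_sums B x U)
  qed (use C x y in auto)
  moreover have "?z + ?w = \<i> * of_real (t - s)" by (simp add: algebra_simps)
  ultimately have "(\<lambda>n. (\<i> * of_real (t - s)) ^ n / fact n * ip K ((A ^^ n) x) y) sums
      ip K (exp_i_op K A t x) (exp_i_op K A s y)"
    by (simp only:)
  then show ?thesis
    by (rule sums_unique2[OF _ ip_exp_i_op_sums[OF B x y]])
qed

lemma hnorm_exp_i_op:
  assumes A: "bounded_self_adjoint K A" and x: "x \<in> vecs K"
  shows "hnorm K (exp_i_op K A t x) = hnorm K x"
proof -
  have B: "bounded_operator K A" using A by (simp add: bounded_self_adjoint_def)
  have "(\<lambda>k. (\<i> * of_real 0) ^ k / fact k * ip K ((A ^^ k) x) x) sums ip K x x"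
    using powser_sums_zero[of "\<lambda>k. ip K ((A ^^ k) x) x / fact k"] by (simp add: mult.commute)
  then have "ip K (exp_i_op K A 0 x) x = ip K x x"
    by (rule sums_unique2[OF ip_exp_i_op_sums[OF B x x]])
  then show ?thesis
    using ip_exp_i_op_exp_i_op[OF A x x, of t t] by (simp add: hnorm_def)
qed

text \<open>
  The inner product of the orbit at times \<open>t\<close> and \<open>s\<close> is the autocorrelation at time \<open>t - s\<close>, so the orbit
  is an almost orthogonal family.
\<close>

lemma exp_i_op_weakly_null:
  assumes A: "bounded_self_adjoint K A" and x: "x \<in> vecs K" and y: "y \<in> vecs K"
    and autocorr: "((\<lambda>t. ip K (exp_i_op K A t x) x) \<longlongrightarrow> 0) at_top"
  shows "((\<lambda>t. ip K (exp_i_op K A t x) y) \<longlongrightarrow> 0) at_top"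
proof (rule weakly_null[OF _ _ _ y])
  have B: "bounded_operator K A" using A by (simp add: bounded_self_adjoint_def)
  show "exp_i_op K A t x \<in> vecs K" for t by (rule exp_i_op_vecs[OF B x])
  show "hnorm K (exp_i_op K A t x) \<le> hnorm K x" for t by (simp add: hnorm_exp_i_op[OF A x])
  show "((\<lambda>t. ip K (exp_i_op K A t x) (exp_i_op K A s x)) \<longlongrightarrow> 0) at_top" for s
  proof -
    have "filterlim (\<lambda>t. t - s) at_top at_top"
      using filterlim_tendsto_add_at_top[OF tendsto_const[of "-s"] filterlim_ident] by simp
    from filterlim_compose[OF autocorr this] show ?thesis
      by (simp add: ip_exp_i_op_exp_i_op[OF A x x])
  qed
qed

text \<open>
  An approximation of \<open>x\<close> by \<open>u\<close> is equally good at all times, because the exponential is isometric.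
\<close>

lemma exp_i_op_weakly_null_closure:
  assumes A: "bounded_self_adjoint K A" and y: "y \<in> vecs K" and x: "x \<in> hclosure K S"
    and S: "S \<subseteq> vecs K" and null: "\<And>u. u \<in> S \<Longrightarrow> ((\<lambda>t. ip K (exp_i_op K A t u) y) \<longlongrightarrow> 0) at_top"
  shows "((\<lambda>t. ip K (exp_i_op K A t x) y) \<longlongrightarrow> 0) at_top"
proof (rule tendstoI)
  fix e :: real assume e: "e > 0"
  have B: "bounded_operator K A" using A by (simp add: bounded_self_adjoint_def)
  \<comment> \<open>Adding 1 avoids a division by 0 when \<open>y = 0\<close>.\<close>
  define d where "d = e / (2 * (hnorm K y + 1))"
  have d: "d > 0" "d * hnorm K y \<le> e / 2"
  proof -
    show "d > 0" using e y by (simp add: d_def add_nonneg_pos)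
    have "e * hnorm K y \<le> e * (hnorm K y + 1)" using e by simp
    then show "d * hnorm K y \<le> e / 2"
      using add_nonneg_pos[OF hnorm_nonneg[OF y], of 1] by (simp add: d_def pos_divide_le_eq) (simp add: distrib_left)
  qed
  from x d obtain u where u: "u \<in> S" "hnorm K (x - u) < d" and x': "x \<in> vecs K"
    unfolding hclosure_def by blast
  then have u': "u \<in> vecs K" using S by auto
  have diff: "ip K (exp_i_op K A t x) y - ip K (exp_i_op K A t u) y = ip K (exp_i_op K A t (x - u)) y" for t
  proof -
    have "(\<lambda>k. (\<i> * of_real t) ^ k / fact k * ip K ((A ^^ k) x) y -
        (\<i> * of_real t) ^ k / fact k * ip K ((A ^^ k) u) y) sums
        (ip K (exp_i_op K A t x) y - ip K (exp_i_op K A t u) y)"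
      by (intro sums_diff ip_exp_i_op_sums B x' u' y)
    moreover have "(\<i> * of_real t) ^ k / fact k * ip K ((A ^^ k) x) y -
        (\<i> * of_real t) ^ k / fact k * ip K ((A ^^ k) u) y =
        (\<i> * of_real t) ^ k / fact k * ip K ((A ^^ k) (x - u)) y" for k
      using bounded_operator_vecs[OF bounded_operator_pow[OF B]] x' u' y
      by (simp add: bounded_operator_diff[OF bounded_operator_pow[OF B]] ip_diff_left right_diff_distrib)
    ultimately have "(\<lambda>k. (\<i> * of_real t) ^ k / fact k * ip K ((A ^^ k) (x - u)) y) sums
        (ip K (exp_i_op K A t x) y - ip K (exp_i_op K A t u) y)"
      by (simp only:)
    then show ?thesis
      by (rule sums_unique2[OF _ ip_exp_i_op_sums[OF B diff_vecs[OF x' u'] y]])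
  qed
  have close: "norm (ip K (exp_i_op K A t (x - u)) y) \<le> e / 2" for t
  proof -
    have "norm (ip K (exp_i_op K A t (x - u)) y) \<le> hnorm K (x - u) * hnorm K y"
      using Cauchy_Schwarz[OF exp_i_op_vecs[OF B] y, of "x - u" t] x' u'
      by (simp add: hnorm_exp_i_op[OF A])
    also have "\<dots> \<le> d * hnorm K y" using u y by (intro mult_right_mono) auto
    finally show ?thesis using d by simp
  qed
  have "\<forall>\<^sub>F t in at_top. norm (ip K (exp_i_op K A t u) y) < e / 2"
    using tendstoD[OF null[OF u(1)], of "e / 2"] e by simp
  then show "\<forall>\<^sub>F t in at_top. dist (ip K (exp_i_op K A t x) y) 0 < e"
  proof eventually_elim
    case (elim t)
    then show ?case
      using diff[of t] close[of t] norm_triangle_sub[of "ip K (exp_i_op K A t x) y" "ip K (exp_i_op K A t u) y"]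
      by simp
  qed
qed

section \<open>Moments and Fourier transform of a spectral measure\<close>

lemma bounded_operator_poly_op: "bounded_operator K A \<Longrightarrow> bounded_operator K (poly_op K A p)"
  unfolding poly_op_def
  by (intro bounded_operator_sum bounded_operator_scl bounded_operator_pow)

text \<open>
  The constant sequence of polynomials \<open>p\<close> converges to \<open>p\<close>, uniformly on every set.
\<close>

lemma is_fun_of_operator_poly:
  assumes "bounded_operator K A"
  shows "is_fun_of_operator K A (\<lambda>x. poly p (of_real x)) (poly_op K A p)"
proof -
  have "0 \<in> {x \<in> vecs K. hnorm K x \<le> 1}" by simp
  then have "opnorm K (\<lambda>x. poly_op K A p x - poly_op K A p x) = 0"
    unfolding opnorm_def by (simp add: cSUP_const[OF ex_in_conv[THEN iffD1]] exI[of _ 0])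
  moreover have "uniform_limit (real_spectrum K A) (\<lambda>n x. poly p (complex_of_real x))
      (\<lambda>x. poly p (of_real x)) sequentially"
    by (rule uniform_limit_const)
  ultimately show ?thesis
    unfolding is_fun_of_operator_def using bounded_operator_poly_op[OF assms] by auto
qed

lemma ip_poly_op:
  assumes A: "bounded_operator K A" and u: "u \<in> vecs K" and n: "degree p \<le> n"
  shows "ip K (poly_op K A p u) u = (\<Sum>i\<le>n. coeff p i * ip K ((A ^^ i) u) u)"
proof -
  have [simp]: "(A ^^ i) u \<in> vecs K" for i
    using bounded_operator_vecs[OF bounded_operator_pow[OF A] u] .
  have "ip K (poly_op K A p u) u = (\<Sum>i\<le>degree p. coeff p i * ip K ((A ^^ i) u) u)"
    unfolding poly_op_def using u by (simp add: ip_sum_left ip_scl_left)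
  also have "\<dots> = (\<Sum>i\<le>n. coeff p i * ip K ((A ^^ i) u) u)"
    using n by (intro sum.mono_neutral_left) (auto simp: coeff_eq_0)
  finally show ?thesis .
qed

text \<open>
  The defining property of a spectral measure for the constant function 1 says that
  \<open>\<langle>u, u\<rangle>\<close> is the integral of the indicator function of the spectrum.  The integral of a
  function that is not integrable is 0, while \<open>\<langle>u, u\<rangle> \<noteq> 0\<close>; so the indicator function is measurable.
  Only after this does the condition that \<open>emeasure\<close> vanishes on the complement say that the latter is a null set,
  since \<open>emeasure\<close> is 0 on all sets that are not measurable.
\<close>

lemma spectral_measure_spectrum:
  assumes A: "bounded_operator K A" and \<mu>: "is_spectral_measure K A u \<mu>" and u: "u \<in> vecs K" "u \<noteq> 0"
  shows "real_spectrum K A \<in> sets \<mu>" and "AE x in \<mu>. x \<in> real_spectrum K A"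
proof -
  let ?S = "real_spectrum K A"
  have sets [measurable_cong]: "sets \<mu> = sets borel" using \<mu> by (simp add: is_spectral_measure_def)
  then have space: "space \<mu> = UNIV" using sets_eq_imp_space_eq[OF sets] by simp
  have "ip K (poly_op K A 1 u) u = (LINT x:?S|\<mu>. poly 1 (complex_of_real x))"
    using \<mu> is_fun_of_operator_poly[OF A, of 1] unfolding is_spectral_measure_def
    by (auto simp: continuous_on_const)
  moreover have "ip K (poly_op K A 1 u) u = ip K u u"
    by (subst ip_poly_op[OF A u(1), of 1 0]) simp_all
  moreover have "ip K u u \<noteq> 0" using ip_pos[OF u] by auto
  ultimately have "(\<integral>x. indicator ?S x *\<^sub>R (1::complex) \<partial>\<mu>) \<noteq> 0"
    by (simp add: set_lebesgue_integral_def)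
  then have "integrable \<mu> (\<lambda>x. indicator ?S x *\<^sub>R (1::complex))"
    using not_integrable_integral_eq by blast
  then have "(\<lambda>x. norm (indicator ?S x *\<^sub>R (1::complex))) \<in> borel_measurable \<mu>"
    using borel_measurable_norm borel_measurable_integrable by blast
  then have "(indicator ?S :: real \<Rightarrow> real) \<in> borel_measurable \<mu>"
    by simp
  then show "?S \<in> sets \<mu>" by (simp add: borel_measurable_indicator_iff space)
  then have "- ?S \<in> sets \<mu>" using space sets.compl_sets[of ?S \<mu>] by (simp add: Compl_eq_Diff_UNIV)
  then have "- ?S \<in> null_sets \<mu>" using \<mu> by (simp add: is_spectral_measure_def null_setsI)
  from AE_not_in[OF this] show "AE x in \<mu>. x \<in> ?S" by simp
qed

lemma spectral_measure_poly:
  assumes A: "bounded_operator K A" and \<mu>: "is_spectral_measure K A u \<mu>" and u: "u \<in> vecs K" "u \<noteq> 0"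
  shows "ip K (poly_op K A p u) u = (\<integral>x. poly p (of_real x) \<partial>\<mu>)"
proof -
  let ?S = "real_spectrum K A"
  have sets [measurable_cong]: "sets \<mu> = sets borel" using \<mu> by (simp add: is_spectral_measure_def)
  have poly_meas: "(\<lambda>x. poly p (complex_of_real x)) \<in> borel_measurable \<mu>"
    unfolding measurable_cong_sets[OF sets refl]
    by (intro borel_measurable_continuous_onI continuous_intros)
  have AE: "AE x in \<mu>. indicator ?S x *\<^sub>R poly p (complex_of_real x) = poly p (of_real x)"
    using spectral_measure_spectrum(2)[OF assms] by eventually_elim simp
  have "continuous_on ?S (\<lambda>x. poly p (complex_of_real x))"
    by (intro continuous_intros)
  then have "ip K (poly_op K A p u) u = (LINT x:?S|\<mu>. poly p (complex_of_real x))"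
    using \<mu> is_fun_of_operator_poly[OF A, of p] unfolding is_spectral_measure_def by blast
  also have "\<dots> = (\<integral>x. poly p (of_real x) \<partial>\<mu>)"
    unfolding set_lebesgue_integral_def
  proof (rule integral_cong_AE[OF _ poly_meas AE])
    show "(\<lambda>x. indicator ?S x *\<^sub>R poly p (complex_of_real x)) \<in> borel_measurable \<mu>"
      using poly_meas spectral_measure_spectrum(1)[OF assms] by (intro borel_measurable_scaleR borel_measurable_indicator)
  qed
  finally show ?thesis .
qed

text \<open>
  Integrability of \<open>x\<^sup>k\<close> comes from the convention that other functions have integral 0.  If it failed,
  then \<open>1 + c x\<^sup>k\<close> would not be integrable for any \<open>c \<noteq> 0\<close>, so
  \<open>\<langle>u, u\<rangle> + c \<langle>A\<^sup>k u, u\<rangle> = 0\<close> for \<open>c = 1\<close> and \<open>c = 2\<close>, which forces \<open>\<langle>u, u\<rangle> = 0\<close>.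
\<close>

lemma spectral_measure_moment:
  assumes A: "bounded_operator K A" and \<mu>: "is_spectral_measure K A u \<mu>" and u: "u \<in> vecs K" "u \<noteq> 0"
  shows "integrable \<mu> (\<lambda>x. complex_of_real x ^ k)"
    and "ip K ((A ^^ k) u) u = (\<integral>x. complex_of_real x ^ k \<partial>\<mu>)"
proof -
  interpret \<mu>: finite_measure \<mu> using \<mu> by (simp add: is_spectral_measure_def)
  let ?m = "\<lambda>k. ip K ((A ^^ k) u) u"
  have perturbed: "?m 0 + c * ?m k = (\<integral>x. 1 + c * complex_of_real x ^ k \<partial>\<mu>)" for c
  proof -
    have "ip K (poly_op K A (1 + monom c k) u) u = (\<Sum>i\<le>k. coeff (1 + monom c k) i * ?m i)"
      by (rule ip_poly_op[OF A u(1)]) (simp add: degree_add_le degree_monom_le)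
    also have "\<dots> = (\<Sum>i\<le>k. (if i = 0 then ?m i else 0) + (if i = k then c * ?m i else 0))"
      by (intro sum.cong) (auto simp: distrib_right coeff_1)
    also have "\<dots> = ?m 0 + c * ?m k"
      by (simp add: sum.distrib)
    finally show ?thesis
      using spectral_measure_poly[OF assms, of "1 + monom c k"] by (simp add: poly_monom)
  qed
  show int: "integrable \<mu> (\<lambda>x. complex_of_real x ^ k)"
  proof (rule ccontr)
    assume not_int: "\<not> ?thesis"
    have "?m 0 + c * ?m k = 0" if "c \<noteq> 0" for c
    proof -
      have "\<not> integrable \<mu> (\<lambda>x. 1 + c * complex_of_real x ^ k)"
      proof
        assume "integrable \<mu> (\<lambda>x. 1 + c * complex_of_real x ^ k)"
        then have "integrable \<mu> (\<lambda>x. ((1 + c * complex_of_real x ^ k) - 1) / c)"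
          by (intro integrable_divide Bochner_Integration.integrable_diff) auto
        with not_int that show False by simp
      qed
      then show ?thesis unfolding perturbed by (rule not_integrable_integral_eq)
    qed
    from this[of 1] this[of 2] have "?m 0 = 0" by (simp add: add_eq_0_iff2)
    then show False using ip_pos[OF u] by simp
  qed
  have "?m 0 + 1 * ?m k = (\<integral>x. 1 \<partial>\<mu>) + (\<integral>x. complex_of_real x ^ k \<partial>\<mu>)"
    unfolding perturbed using int by (subst Bochner_Integration.integral_add[symmetric]) auto
  moreover have "?m 0 = (\<integral>x. 1 \<partial>\<mu>)"
    using perturbed[of 0] by simp
  ultimately show "?m k = (\<integral>x. complex_of_real x ^ k \<partial>\<mu>)" by simp
qed

text \<open>
  The power series of \<open>e\<^sup>i\<^sup>t\<^sup>x\<close> is integrated term by term.  This is possible because the absolute moments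
  grow at most geometrically, like the norms of the powers of \<open>A\<close>.
\<close>

lemma spectral_measure_fourier_sums:
  assumes A: "bounded_operator K A" and \<mu>: "is_spectral_measure K A u \<mu>" and u: "u \<in> vecs K" "u \<noteq> 0"
  shows "(\<lambda>k. (\<i> * of_real t) ^ k / fact k * ip K ((A ^^ k) u) u) sums (\<integral>x. cis (t * x) \<partial>\<mu>)"
proof -
  interpret \<mu>: finite_measure \<mu> using \<mu> by (simp add: is_spectral_measure_def)
  note moment = spectral_measure_moment[OF assms]
  obtain C where C: "C \<ge> 1" "\<And>x. x \<in> vecs K \<Longrightarrow> hnorm K (A x) \<le> C * hnorm K x"
    using bounded_operator_bound[OF A] by metis
  define M where "M = measure \<mu> (space \<mu>) + (hnorm K u)\<^sup>2"
  have abs_int: "integrable \<mu> (\<lambda>x. \<bar>x\<bar> ^ k)" for k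
    using integrable_norm[OF moment(1)[of k]] by (simp add: norm_power)
  have abs_moment: "(\<integral>x. \<bar>x\<bar> ^ k \<partial>\<mu>) \<le> M * C ^ k" for k
  proof -
    have int2: "integrable \<mu> (\<lambda>x. x ^ (2 * k))"
      using abs_int[of "2 * k"] by (simp add: power_even_abs)
    have "(\<integral>x. complex_of_real x ^ (2 * k) \<partial>\<mu>) = of_real (\<integral>x. x ^ (2 * k) \<partial>\<mu>)"
      using integral_complex_of_real[of \<mu> "\<lambda>x. x ^ (2 * k)"] by simp
    then have "(\<integral>x. x ^ (2 * k) \<partial>\<mu>) \<le> norm (ip K ((A ^^ (2 * k)) u) u)"
      unfolding moment(2) by simp
    also have "\<dots> \<le> (hnorm K u)\<^sup>2 * C ^ (2 * k)"
      unfolding power2_eq_square using C by (intro ip_pow_le A u) auto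
    finally have even: "(\<integral>x. x ^ (2 * k) \<partial>\<mu>) \<le> (hnorm K u)\<^sup>2 * C ^ (2 * k)" .
    \<comment> \<open>Only even moments are moments of nonnegative functions; this bounds all absolute moments by them.\<close>
    have "\<bar>x\<bar> ^ k \<le> C ^ k + x ^ (2 * k) / C ^ k" for x :: real
    proof (cases "\<bar>x\<bar> \<le> C")
      case True
      then have "\<bar>x\<bar> ^ k \<le> C ^ k" by (intro power_mono) auto
      also have "\<dots> \<le> C ^ k + x ^ (2 * k) / C ^ k" using C(1) by simp
      finally show ?thesis .
    next
      case False
      then have "C ^ k * \<bar>x\<bar> ^ k \<le> \<bar>x\<bar> ^ k * \<bar>x\<bar> ^ k"
        using C(1) by (intro mult_right_mono power_mono) auto
      also have "\<dots> = x ^ (2 * k)" by (simp add: mult_2 power_add flip: power_mult_distrib)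
      finally have "\<bar>x\<bar> ^ k \<le> x ^ (2 * k) / C ^ k"
        using C(1) by (simp add: pos_le_divide_eq mult.commute)
      then show ?thesis using C(1) by (simp add: add_increasing)
    qed
    then have "(\<integral>x. \<bar>x\<bar> ^ k \<partial>\<mu>) \<le> (\<integral>x. C ^ k + x ^ (2 * k) / C ^ k \<partial>\<mu>)"
      by (intro integral_mono abs_int Bochner_Integration.integrable_add integrable_divide int2) auto
    also have "\<dots> = measure \<mu> (space \<mu>) * C ^ k + (\<integral>x. x ^ (2 * k) \<partial>\<mu>) / C ^ k"
      using int2 by (subst Bochner_Integration.integral_add) auto
    also have "\<dots> \<le> measure \<mu> (space \<mu>) * C ^ k + ((hnorm K u)\<^sup>2 * C ^ (2 * k)) / C ^ k"
      using even C(1) by (intro add_left_mono divide_right_mono) auto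
    also have "\<dots> = M * C ^ k"
      using C(1) by (simp add: M_def mult_2 power_add distrib_right)
    finally show ?thesis .
  qed
  have exp_sum: "summable (\<lambda>k. x ^ k / fact k)" for x :: real
    using summable_exp_generic[of x] by (simp add: field_simps)
  let ?f = "\<lambda>k x. (\<i> * of_real t) ^ k / fact k * complex_of_real x ^ k"
  have norm_f: "norm (?f k x) = \<bar>t\<bar> ^ k / fact k * \<bar>x\<bar> ^ k" for k x
    by (simp add: norm_mult norm_divide norm_power)
  have "(\<lambda>k. \<integral>x. ?f k x \<partial>\<mu>) sums (\<integral>x. (\<Sum>k. ?f k x) \<partial>\<mu>)"
  proof (rule sums_integral)
    show "integrable \<mu> (?f k)" for k using moment(1) by (intro integrable_mult_right)
    show "AE x in \<mu>. summable (\<lambda>k. norm (?f k x))"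
      unfolding norm_f using exp_sum[of "\<bar>t\<bar> * \<bar>_\<bar>"]
      by (intro AE_I2) (simp add: power_mult_distrib)
    show "summable (\<lambda>k. \<integral>x. norm (?f k x) \<partial>\<mu>)"
    proof (rule summable_comparison_test')
      show "summable (\<lambda>k. (\<bar>t\<bar> * C) ^ k / fact k * M)"
        by (rule summable_mult2[OF exp_sum])
      show "norm (\<integral>x. norm (?f k x) \<partial>\<mu>) \<le> (\<bar>t\<bar> * C) ^ k / fact k * M" for k
      proof -
        have "norm (\<integral>x. norm (?f k x) \<partial>\<mu>) = \<bar>t\<bar> ^ k / fact k * (\<integral>x. \<bar>x\<bar> ^ k \<partial>\<mu>)"
          unfolding norm_f by (simp add: abs_mult)
        also have "\<dots> \<le> \<bar>t\<bar> ^ k / fact k * (M * C ^ k)"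
          by (intro mult_left_mono abs_moment) simp
        finally show ?thesis by (simp add: power_mult_distrib mult_ac)
      qed
    qed
  qed
  moreover have "(\<Sum>k. ?f k x) = cis (t * x)" for x
  proof -
    have "(\<lambda>k. (\<i> * of_real (t * x)) ^ k /\<^sub>R fact k) sums exp (\<i> * of_real (t * x))"
      by (rule exp_converges)
    moreover have "(\<i> * of_real (t * x)) ^ k /\<^sub>R fact k = ?f k x" for k
      by (simp add: power_mult_distrib scaleR_conv_of_real field_simps)
    ultimately show ?thesis by (simp add: cis_conv_exp sums_iff)
  qed
  moreover have "(\<integral>x. ?f k x \<partial>\<mu>) = (\<i> * of_real t) ^ k / fact k * ip K ((A ^^ k) u) u" for k
    unfolding moment(2) by simp
  ultimately show ?thesis by (simp only:)
qed

end

section \<open>The exponential on a tensor power\<close>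

lemma fps_deriv_prod:
  fixes f :: "'i \<Rightarrow> 'a::comm_ring_1 fps"
  assumes "finite I"
  shows "fps_deriv (\<Prod>i\<in>I. f i) = (\<Sum>i\<in>I. fps_deriv (f i) * (\<Prod>j\<in>I - {i}. f j))"
  using assms
proof (induction I rule: finite_induct)
  case (insert a I)
  have "(\<Sum>i\<in>I. fps_deriv (f i) * (\<Prod>j\<in>insert a I - {i}. f j)) =
      (\<Sum>i\<in>I. f a * (fps_deriv (f i) * (\<Prod>j\<in>I - {i}. f j)))"
  proof (rule sum.cong[OF refl])
    fix i assume "i \<in> I"
    then have "insert a I - {i} = insert a (I - {i})" using insert by auto
    then show "fps_deriv (f i) * (\<Prod>j\<in>insert a I - {i}. f j) =
        f a * (fps_deriv (f i) * (\<Prod>j\<in>I - {i}. f j))"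
      using insert by (simp add: mult_ac)
  qed
  moreover have "insert a I - {a} = I" using insert by auto
  ultimately show ?case
    using insert by (simp add: sum_distrib_left mult_ac)
qed simp

lemma fps_prod_nth_0: "fps_nth (\<Prod>i\<in>I. f i) 0 = (\<Prod>i\<in>I. fps_nth (f i) 0)"
  for f :: "'i \<Rightarrow> 'a::comm_ring_1 fps"
  by (induction I rule: infinite_finite_induct) simp_all

text \<open>
  The exponential generating function of the sequence \<open>a\<^sub>n, a\<^sub>n\<^sub>+\<^sub>1, \<dots>\<close>.  The shift \<open>n\<close> turns
  differentiation into an increment of the index.
\<close>

definition moment_fps :: "(nat \<Rightarrow> complex) \<Rightarrow> nat \<Rightarrow> complex fps" where
  "moment_fps a n = Abs_fps (\<lambda>k. a (n + k) / fact k)"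

lemma fps_deriv_moment_fps: "fps_deriv (moment_fps a n) = moment_fps a (Suc n)"
  by (rule fps_ext) (simp add: moment_fps_def field_simps del: of_nat_Suc)

lemma fps_deriv_prod_moment_fps:
  assumes "length ns = N"
  shows "fps_deriv (\<Prod>i<N. moment_fps a (ns ! i)) =
    (\<Sum>j<N. \<Prod>i<N. moment_fps a (ns[j := Suc (ns ! j)] ! i))"
proof -
  have "fps_deriv (moment_fps a (ns ! j)) * (\<Prod>i\<in>{..<N} - {j}. moment_fps a (ns ! i)) =
      (\<Prod>i<N. moment_fps a (ns[j := Suc (ns ! j)] ! i))" if "j < N" for j
  proof -
    have "(\<Prod>i<N. moment_fps a (ns[j := Suc (ns ! j)] ! i)) =
        moment_fps a (Suc (ns ! j)) * (\<Prod>i\<in>{..<N} - {j}. moment_fps a (ns[j := Suc (ns ! j)] ! i))"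
      using that assms by (subst prod.remove[of _ j]) auto
    also have "(\<Prod>i\<in>{..<N} - {j}. moment_fps a (ns[j := Suc (ns ! j)] ! i)) =
        (\<Prod>i\<in>{..<N} - {j}. moment_fps a (ns ! i))"
      by (intro prod.cong) auto
    finally show ?thesis by (simp add: fps_deriv_moment_fps)
  qed
  then show ?thesis by (subst fps_deriv_prod) auto
qed

text \<open>
  Both sides satisfy the same recursion in \<open>k\<close>.  Applying the sum operator to the tensor product of
  the vectors \<open>A\<^sup>n \<psi>\<close> gives the sum of the tensor products in which one exponent is raised by 1, and
  by the product rule the derivative of the product of the generating functions does the same to
  their indices.
  The statement is needed for all lists of exponents because the recursion leaves
  the constant list \<open>0, \<dots>, 0\<close>.
\<close>

lemma tensor_sum_moments:
  fixes H :: "'v::ab_group_add inner_space" and K :: "'w::ab_group_add inner_space"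
  assumes H: "complex_hilbert_space H" and A: "bounded_operator H A" and psi: "\<psi> \<in> vecs H"
    and tensor: "is_tensor_power H N K \<tau>"
    and T: "\<And>k. k < N \<Longrightarrow> is_factor_operator H N K \<tau> A k (T k)"
    and len: "length ns = N"
  shows "ip K (((\<lambda>F. \<Sum>k<N. T k F) ^^ k) (\<tau> (map (\<lambda>n. (A ^^ n) \<psi>) ns))) (\<tau> (replicate N \<psi>)) =
    fact k * fps_nth (\<Prod>i<N. moment_fps (\<lambda>n. ip H ((A ^^ n) \<psi>) \<psi>) (ns ! i)) k"
  using len
proof (induction k arbitrary: ns)
  interpret H: complex_hilbert_space H by (rule H)
  interpret K: complex_hilbert_space K using tensor by (simp add: is_tensor_power_def)
  have pow: "(A ^^ n) \<psi> \<in> vecs H" for n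
    using H.bounded_operator_vecs[OF H.bounded_operator_pow[OF A] psi] .
  have tup: "map (\<lambda>n. (A ^^ n) \<psi>) ns \<in> tuples H N" if "length ns = N" for ns
    using pow that by (auto simp: tuples_def)
  have psis: "replicate N \<psi> \<in> tuples H N" using psi by (auto simp: tuples_def)
  have tau: "\<tau> xs \<in> vecs K" if "xs \<in> tuples H N" for xs
    using tensor that by (simp add: is_tensor_power_def)
  let ?S = "\<lambda>F. \<Sum>k<N. T k F"
  {
    case 0
    have "ip K (\<tau> (map (\<lambda>n. (A ^^ n) \<psi>) ns)) (\<tau> (replicate N \<psi>)) =
        (\<Prod>i<N. ip H (map (\<lambda>n. (A ^^ n) \<psi>) ns ! i) (replicate N \<psi> ! i))"
      using tensor tup[OF 0] psis unfolding is_tensor_power_def by blast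
    with 0 show ?case by (simp add: fps_prod_nth_0 moment_fps_def)
  next
    case (Suc k)
    have S: "bounded_operator K ?S"
      using T by (intro K.bounded_operator_sum) (auto simp: is_factor_operator_def)
    have step: "?S (\<tau> (map (\<lambda>n. (A ^^ n) \<psi>) ns)) =
        (\<Sum>j<N. \<tau> (map (\<lambda>n. (A ^^ n) \<psi>) (ns[j := Suc (ns ! j)])))"
    proof (rule sum.cong[OF refl])
      fix j assume "j \<in> {..<N}"
      then show "T j (\<tau> (map (\<lambda>n. (A ^^ n) \<psi>) ns)) = \<tau> (map (\<lambda>n. (A ^^ n) \<psi>) (ns[j := Suc (ns ! j)]))"
        using T[of j] tup[OF Suc.prems] Suc.prems by (simp add: is_factor_operator_def map_update)
    qed
    have in_K: "\<tau> (map (\<lambda>n. (A ^^ n) \<psi>) (ns[j := Suc (ns ! j)])) \<in> vecs K" for j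
      by (intro tau tup) (simp add: Suc.prems)
    have "ip K ((?S ^^ Suc k) (\<tau> (map (\<lambda>n. (A ^^ n) \<psi>) ns))) (\<tau> (replicate N \<psi>)) =
        ip K (\<Sum>j<N. (?S ^^ k) (\<tau> (map (\<lambda>n. (A ^^ n) \<psi>) (ns[j := Suc (ns ! j)])))) (\<tau> (replicate N \<psi>))"
      unfolding funpow_Suc_right o_apply step
      by (subst K.bounded_operator_sum_distrib[OF K.bounded_operator_pow[OF S]]) (auto intro: in_K)
    also have "\<dots> = (\<Sum>j<N. ip K ((?S ^^ k) (\<tau> (map (\<lambda>n. (A ^^ n) \<psi>) (ns[j := Suc (ns ! j)]))))
        (\<tau> (replicate N \<psi>)))"
      by (intro K.ip_sum_left K.bounded_operator_vecs[OF K.bounded_operator_pow[OF S]] in_K tau psis)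
    also have "\<dots> = (\<Sum>j<N. fact k *
        fps_nth (\<Prod>i<N. moment_fps (\<lambda>n. ip H ((A ^^ n) \<psi>) \<psi>) (ns[j := Suc (ns ! j)] ! i)) k)"
      by (intro sum.cong refl Suc.IH) (simp add: Suc.prems)
    also have "\<dots> = fact k * fps_nth (fps_deriv (\<Prod>i<N. moment_fps (\<lambda>n. ip H ((A ^^ n) \<psi>) \<psi>) (ns ! i))) k"
      by (simp add: fps_deriv_prod_moment_fps[OF Suc.prems] fps_sum_nth sum_distrib_left del: fps_deriv_nth)
    also have "\<dots> = fact (Suc k) * fps_nth (\<Prod>i<N. moment_fps (\<lambda>n. ip H ((A ^^ n) \<psi>) \<psi>) (ns ! i)) (Suc k)"
      by (simp add: mult_ac)
    finally show ?case .
  }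
qed

text \<open>
  For the constant list of exponents 0 the generating function of the moments is an \<open>N\<close>-th power, and
  evaluation of a power series is multiplicative inside the disc of convergence, here the whole plane.
\<close>

lemma tensor_sum_exponential_series:
  fixes H :: "'v::ab_group_add inner_space" and K :: "'w::ab_group_add inner_space"
  assumes H: "complex_hilbert_space H" and A: "bounded_operator H A" and psi: "\<psi> \<in> vecs H"
    and tensor: "is_tensor_power H N K \<tau>"
    and T: "\<And>k. k < N \<Longrightarrow> is_factor_operator H N K \<tau> A k (T k)"
  shows "(\<lambda>k. (\<i> * of_real t) ^ k / fact k *
      ip K (((\<lambda>F. \<Sum>k<N. T k F) ^^ k) (\<tau> (replicate N \<psi>))) (\<tau> (replicate N \<psi>)))
    sums (ip H (exp_i_op H A t \<psi>) \<psi> ^ N)"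
proof -
  interpret H: complex_hilbert_space H by (rule H)
  define a where "a = (\<lambda>n. ip H ((A ^^ n) \<psi>) \<psi>)"
  let ?g = "moment_fps a 0" and ?z = "\<i> * complex_of_real t"
  obtain C where C: "C \<ge> 1" "\<And>x. x \<in> vecs H \<Longrightarrow> hnorm H (A x) \<le> C * hnorm H x"
    using H.bounded_operator_bound[OF A] by metis
  have rad: "fps_conv_radius ?g = \<infinity>"
    unfolding fps_conv_radius_def
  proof (rule conv_radius_inftyI'')
    fix z :: complex
    have "summable (\<lambda>k. (norm z * C) ^ k / fact k * (hnorm H \<psi> * hnorm H \<psi>))"
      using summable_exp_generic[of "norm z * C"] by (intro summable_mult2) (simp add: field_simps)
    moreover have "norm (fps_nth ?g k * z ^ k) \<le> (norm z * C) ^ k / fact k * (hnorm H \<psi> * hnorm H \<psi>)" for k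
    proof -
      have "norm (fps_nth ?g k * z ^ k) = norm (ip H ((A ^^ k) \<psi>) \<psi>) * (norm z ^ k / fact k)"
        by (simp add: moment_fps_def a_def norm_mult norm_divide norm_power)
      also have "\<dots> \<le> (hnorm H \<psi> * hnorm H \<psi> * C ^ k) * (norm z ^ k / fact k)"
        using C by (intro mult_right_mono H.ip_pow_le A psi) auto
      finally show ?thesis by (simp add: power_mult_distrib mult_ac)
    qed
    ultimately show "summable (\<lambda>k. fps_nth ?g k * z ^ k)"
      by (rule summable_comparison_test'[where N = 0])
  qed
  have "(\<lambda>k. fps_nth ?g k * ?z ^ k) sums eval_fps ?g ?z"
    by (rule sums_eval_fps) (simp add: rad)
  moreover have "fps_nth ?g k * ?z ^ k = ?z ^ k / fact k * ip H ((A ^^ k) \<psi>) \<psi>" for k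
    by (simp add: moment_fps_def a_def)
  ultimately have "(\<lambda>k. ?z ^ k / fact k * ip H ((A ^^ k) \<psi>) \<psi>) sums eval_fps ?g ?z"
    by (simp only:)
  then have eval: "eval_fps ?g ?z = ip H (exp_i_op H A t \<psi>) \<psi>"
    by (rule sums_unique2[OF _ H.ip_exp_i_op_sums[OF A psi psi]])
  have "ereal (norm ?z) < fps_conv_radius (?g ^ N)"
    by (rule less_le_trans[OF _ fps_conv_radius_power]) (simp add: rad)
  then have "(\<lambda>k. fps_nth (?g ^ N) k * ?z ^ k) sums eval_fps (?g ^ N) ?z"
    by (rule sums_eval_fps)
  moreover have "eval_fps (?g ^ N) ?z = ip H (exp_i_op H A t \<psi>) \<psi> ^ N"
    by (subst eval_fps_power) (simp_all add: rad eval)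
  moreover have "fps_nth (?g ^ N) k * ?z ^ k = ?z ^ k / fact k *
      ip K (((\<lambda>F. \<Sum>k<N. T k F) ^^ k) (\<tau> (replicate N \<psi>))) (\<tau> (replicate N \<psi>))" for k
    using tensor_sum_moments[OF assms, of "replicate N 0" k] by (simp add: a_def)
  ultimately show ?thesis by (simp only:)
qed

text \<open>
  The Fourier transform of \<open>\<mu>\<close> is the \<open>N\<close>-th power of the autocorrelation, and it tends to 0.
\<close>

lemma eac_autocorrelation_tendsto:
  assumes H: "complex_hilbert_space H" and A: "bounded_operator H A" and psi: "\<psi> \<in> vecs H"
    and N: "N \<ge> 1" and \<mu>: "is_tensor_spectral_measure H A N \<psi> \<mu>"
    and ac: "absolutely_continuous lborel \<mu>"
  shows "((\<lambda>t. ip H (exp_i_op H A t \<psi>) \<psi>) \<longlongrightarrow> 0) at_top"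
proof (cases "\<psi> = 0")
  case True
  interpret H: complex_hilbert_space H by (rule H)
  show ?thesis using H.exp_i_op_vecs[OF A psi] by (simp add: True)
next
  case False
  interpret H: complex_hilbert_space H by (rule H)
  obtain K :: "('a list \<Rightarrow> complex) inner_space" and \<tau> T where tensor: "is_tensor_power H N K \<tau>"
    and T: "\<And>k. k < N \<Longrightarrow> is_factor_operator H N K \<tau> A k (T k)"
    and spec: "is_spectral_measure K (\<lambda>F. \<Sum>k<N. T k F) (\<tau> (replicate N \<psi>)) \<mu>"
    using \<mu> unfolding is_tensor_spectral_measure_def by blast
  interpret K: complex_hilbert_space K using tensor by (simp add: is_tensor_power_def)
  have psis: "replicate N \<psi> \<in> tuples H N" using psi by (auto simp: tuples_def)
  have vec: "\<tau> (replicate N \<psi>) \<in> vecs K"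
    using tensor psis by (simp add: is_tensor_power_def)
  have "ip K (\<tau> (replicate N \<psi>)) (\<tau> (replicate N \<psi>)) = (\<Prod>i<N. ip H (replicate N \<psi> ! i) (replicate N \<psi> ! i))"
    using tensor psis unfolding is_tensor_power_def by blast
  also have "\<dots> = ip H \<psi> \<psi> ^ N" by simp
  also have "\<dots> \<noteq> 0" using H.ip_pos[OF psi False] by auto
  finally have nz: "\<tau> (replicate N \<psi>) \<noteq> 0" using vec by auto
  have S: "bounded_operator K (\<lambda>F. \<Sum>k<N. T k F)"
    using T by (intro K.bounded_operator_sum) (auto simp: is_factor_operator_def)
  have eq: "ip H (exp_i_op H A t \<psi>) \<psi> ^ N = (\<integral>x. cis (t * x) \<partial>\<mu>)" for t
    by (rule sums_unique2[OF tensor_sum_exponential_series[OF H A psi tensor T]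
        K.spectral_measure_fourier_sums[OF S spec vec nz]])
  have "((\<lambda>t. \<integral>x. cis (t * x) \<partial>\<mu>) \<longlongrightarrow> 0) at_top"
    using spec ac by (intro Riemann_Lebesgue_measure) (auto simp: is_spectral_measure_def)
  then have power: "((\<lambda>t. ip H (exp_i_op H A t \<psi>) \<psi> ^ N) \<longlongrightarrow> 0) at_top"
    by (simp only: eq)
  show ?thesis
  proof (rule tendstoI)
    fix e :: real assume e: "e > 0"
    then have "\<forall>\<^sub>F t in at_top. dist (ip H (exp_i_op H A t \<psi>) \<psi> ^ N) 0 < e ^ N"
      by (intro tendstoD[OF power]) simp
    then show "\<forall>\<^sub>F t in at_top. dist (ip H (exp_i_op H A t \<psi>) \<psi>) 0 < e"
    proof eventually_elim
      case (elim t)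
      then have "norm (ip H (exp_i_op H A t \<psi>) \<psi>) ^ N < e ^ N" by (simp add: norm_power)
      then show ?case using e by (auto intro: power_less_imp_less_base)
    qed
  qed
qed

theorem theorem1p2:
  fixes H :: "'v::ab_group_add inner_space"
    and A :: "'v \<Rightarrow> 'v"
    and \<psi> \<phi> :: 'v
  assumes "complex_hilbert_space H"
    and "bounded_self_adjoint H A"
    and "\<psi> \<in> H_eac H A"
    and "\<phi> \<in> vecs H"
  shows "((\<lambda>t::real. ip H (exp_i_op H A t \<psi>) \<phi>) \<longlongrightarrow> 0) at_top"
proof -
  interpret complex_hilbert_space H by (rule assms)
  have A: "bounded_operator H A" using assms(2) by (simp add: bounded_self_adjoint_def)
  show ?thesis
    using assms(3) unfolding H_eac_def
  proof (rule exp_i_op_weakly_null_closure[OF assms(2,4)])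
    fix u assume "u \<in> {\<psi> \<in> vecs H. \<exists>N\<ge>1. \<exists>\<mu>. is_tensor_spectral_measure H A N \<psi> \<mu> \<and>
        absolutely_continuous lborel \<mu>}"
    then show "((\<lambda>t. ip H (exp_i_op H A t u) \<phi>) \<longlongrightarrow> 0) at_top"
      using eac_autocorrelation_tendsto[OF assms(1) A] exp_i_op_weakly_null[OF assms(2) _ assms(4)]
      by blast
  qed auto
qed

end
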